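(* Let $k$ be a field of positive characteristic, let $p$ be a prime number, and let $G$ be a $p$-adic analytic group. Let $0\to V_1\to V_2\to V_3\to 0$ be a short exact sequence in $\mathrm{Rep}_k(G)$. If $V_1$ and $V_3$ are smooth, then $V_2$ is smooth.
   Context: A $p$-adic analytic group is a topological group carrying the structure of a $p$-adic analytic manifold over $\mathbb{Q}_p$ with analytic group operations; equivalently, a topological group containing an open subgroup that is a finitely generated powerful pro-$p$ group. (A pro-$p$ group $U$ is powerful if $p$ is odd and $U/\overline{U^p}$ is abelian, or $p=2$ and $U/\overline{U^4}$ is abelian, where $U^n$ is the subgroup generated by the $n$-th powers and the bar denotes topological closure.) $G$ is not assumed compact, and $p$ need not be the characteristic of $k$. $\mathrm{Rep}_k(G)$ is the category of all $k$-linear representations of the abstract group $G$ on $k$-vector spaces. A representation $V$ is smooth if the action map $G\times V\to V$ is continuous when $V$ has the discrete topology; equivalently, the stabilizer of every vector is open in $G$. *)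

theory Defs
  imports "HOL-Analysis.Analysis" "HOL-Algebra.Module" "HOL-Algebra.Group_Action" "HOL-Algebra.Exact_Sequence" "HOL-Algebra.AbelCoset"
    "HOL-Algebra.Generated_Groups"
begin

section \<open>Topological groups and p-adic analytic groups\<close>

locale topological_group = group G for G (structure) +
  fixes T :: "'a topology"
  assumes topspace_eq: "topspace T = carrier G"
    and continuous_mult: "continuous_map (prod_topology T T) T (\<lambda>(x, y). x \<otimes> y)"
    and continuous_inv: "continuous_map T T (\<lambda>x. inv x)"

text \<open>
  A profinite group is a compact Hausdorff topological group whose open subgroups form a
  neighbourhood base at the identity; it is pro-\<open>p\<close> if every open normal subgroup has
  index a power of \<open>p\<close>.
\<close>

definition profinite_group :: "('a, 'b) monoid_scheme \<Rightarrow> 'a topology \<Rightarrow> bool" where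
  "profinite_group G T \<longleftrightarrow>
     topological_group G T \<and> compact_space T \<and> Hausdorff_space T \<and>
     (\<forall>W. openin T W \<and> \<one>\<^bsub>G\<^esub> \<in> W \<longrightarrow> (\<exists>H. subgroup H G \<and> openin T H \<and> H \<subseteq> W))"

definition pro_p_group :: "nat \<Rightarrow> ('a, 'b) monoid_scheme \<Rightarrow> 'a topology \<Rightarrow> bool" where
  "pro_p_group p G T \<longleftrightarrow>
     profinite_group G T \<and>
     (\<forall>N. N \<lhd> G \<and> openin T N \<longrightarrow> (\<exists>m. card (rcosets\<^bsub>G\<^esub> N) = p ^ m))"

definition power_subgroup :: "('a, 'b) monoid_scheme \<Rightarrow> nat \<Rightarrow> 'a set" where
  "power_subgroup G n = generate G {x [^]\<^bsub>G\<^esub> n | x. x \<in> carrier G}"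

definition powerful_pro_p_group :: "nat \<Rightarrow> ('a, 'b) monoid_scheme \<Rightarrow> 'a topology \<Rightarrow> bool" where
  "powerful_pro_p_group p G T \<longleftrightarrow>
     pro_p_group p G T \<and>
     ((odd p \<and> comm_group (G Mod (T closure_of power_subgroup G p))) \<or>
      (p = 2 \<and> comm_group (G Mod (T closure_of power_subgroup G 4))))"

text \<open>For profinite groups, ``finitely generated'' is meant in the topological sense.\<close>

definition topologically_fin_gen :: "('a, 'b) monoid_scheme \<Rightarrow> 'a topology \<Rightarrow> bool" where
  "topologically_fin_gen G T \<longleftrightarrow>
     (\<exists>S. finite S \<and> S \<subseteq> carrier G \<and> T closure_of generate G S = carrier G)"

text \<open>
  The group-theoretic definition of a \<open>p\<close>-adic analytic group, which by Lazard's theorem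
  agrees with the one through analytic manifolds over \<open>Q\<^sub>p\<close>. No compactness is required.
\<close>

definition p_adic_analytic_group :: "nat \<Rightarrow> ('a, 'b) monoid_scheme \<Rightarrow> 'a topology \<Rightarrow> bool" where
  "p_adic_analytic_group p G T \<longleftrightarrow>
     topological_group G T \<and>
     (\<exists>U. subgroup U G \<and> openin T U \<and>
          powerful_pro_p_group p (G\<lparr>carrier := U\<rparr>) (subtopology T U) \<and>
          topologically_fin_gen (G\<lparr>carrier := U\<rparr>) (subtopology T U))"


section \<open>Representations\<close>

text \<open>The analogue, for rings with an explicit carrier, of the type class constant \<open>CHAR\<close>.\<close>

definition ring_characteristic :: "('a, 'b) ring_scheme \<Rightarrow> nat" where
  "ring_characteristic R = Gcd {n. [n] \<cdot>\<^bsub>R\<^esub> \<one>\<^bsub>R\<^esub> = \<zero>\<^bsub>R\<^esub>}"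

definition linear_maps ::
    "('k, 'r) ring_scheme \<Rightarrow> ('k, 'v, 'm) module_scheme \<Rightarrow> ('k, 'w, 'n) module_scheme \<Rightarrow> ('v \<Rightarrow> 'w) set"
  where
  "linear_maps K V W =
     {f \<in> carrier V \<rightarrow> carrier W.
        (\<forall>x\<in>carrier V. \<forall>y\<in>carrier V. f (x \<oplus>\<^bsub>V\<^esub> y) = f x \<oplus>\<^bsub>W\<^esub> f y) \<and>
        (\<forall>a\<in>carrier K. \<forall>x\<in>carrier V. f (a \<odot>\<^bsub>V\<^esub> x) = a \<odot>\<^bsub>W\<^esub> f x)}"

text \<open>
  Objects of \<open>Rep_K(G)\<close>: the topology of \<open>G\<close> plays no role here. The locale
  \<^locale>\<open>group_action\<close> takes its values in bijections that are extensional, i.e. undefined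
  off the carrier; this only fixes junk values.
\<close>

definition group_representation ::
    "('k, 'r) ring_scheme \<Rightarrow> ('g, 'h) monoid_scheme \<Rightarrow> ('k, 'v, 'm) module_scheme \<Rightarrow> ('g \<Rightarrow> 'v \<Rightarrow> 'v) \<Rightarrow> bool"
  where
  "group_representation K G V \<rho> \<longleftrightarrow>
     module K V \<and> group_action G (carrier V) \<rho> \<and> (\<forall>g\<in>carrier G. \<rho> g \<in> linear_maps K V V)"

definition rep_hom ::
    "('k, 'r) ring_scheme \<Rightarrow> ('g, 'h) monoid_scheme \<Rightarrow>
     ('k, 'v, 'm) module_scheme \<Rightarrow> ('g \<Rightarrow> 'v \<Rightarrow> 'v) \<Rightarrow>
     ('k, 'w, 'n) module_scheme \<Rightarrow> ('g \<Rightarrow> 'w \<Rightarrow> 'w) \<Rightarrow> ('v \<Rightarrow> 'w) set"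
  where
  "rep_hom K G V \<rho> W \<sigma> =
     {f \<in> linear_maps K V W. \<forall>g\<in>carrier G. \<forall>x\<in>carrier V. f (\<rho> g x) = \<sigma> g (f x)}"

text \<open>
  The library constant \<^const>\<open>short_exact_sequence\<close> forces all three groups to live on one
  type, so exactness is spelled out.
\<close>

definition rep_short_exact ::
    "('k, 'r) ring_scheme \<Rightarrow> ('g, 'h) monoid_scheme \<Rightarrow>
     ('k, 'u, 'l) module_scheme \<Rightarrow> ('g \<Rightarrow> 'u \<Rightarrow> 'u) \<Rightarrow> ('u \<Rightarrow> 'v) \<Rightarrow>
     ('k, 'v, 'm) module_scheme \<Rightarrow> ('g \<Rightarrow> 'v \<Rightarrow> 'v) \<Rightarrow> ('v \<Rightarrow> 'w) \<Rightarrow>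
     ('k, 'w, 'n) module_scheme \<Rightarrow> ('g \<Rightarrow> 'w \<Rightarrow> 'w) \<Rightarrow> bool"
  where
  "rep_short_exact K G V1 \<rho>1 \<alpha> V2 \<rho>2 \<beta> V3 \<rho>3 \<longleftrightarrow>
     group_representation K G V1 \<rho>1 \<and> group_representation K G V2 \<rho>2 \<and> group_representation K G V3 \<rho>3 \<and>
     \<alpha> \<in> rep_hom K G V1 \<rho>1 V2 \<rho>2 \<and> \<beta> \<in> rep_hom K G V2 \<rho>2 V3 \<rho>3 \<and>
     inj_on \<alpha> (carrier V1) \<and> \<alpha> ` carrier V1 = a_kernel V2 V3 \<beta> \<and> \<beta> ` carrier V2 = carrier V3"

definition smooth_rep ::
    "'g topology \<Rightarrow> ('k, 'v, 'm) module_scheme \<Rightarrow> ('g \<Rightarrow> 'v \<Rightarrow> 'v) \<Rightarrow> bool"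
  where
  "smooth_rep T V \<rho> \<longleftrightarrow>
     continuous_map (prod_topology T (discrete_topology (carrier V)))
       (discrete_topology (carrier V)) (\<lambda>(g, x). \<rho> g x)"

end

theory Submission
  imports Defs "HOL-Algebra.Multiplicative_Group"
begin

text \<open>
  Smoothness of a representation means that all vectors have open stabilizers, and this may be
  tested in the open powerful pro-\<open>p\<close> subgroup \<open>U\<close> of \<open>G\<close>. Let \<open>v\<close> be a vector of \<open>V2\<close>. Its image
  in \<open>V3\<close> has an open stabilizer \<open>H\<close>, and \<open>c g = g v - v\<close> is a cocycle on \<open>H\<close> with values in
  (the image of) \<open>V1\<close>. The values of \<open>c\<close> have open stabilizers, but these vary with the value, and
  no continuity of \<open>c\<close> is known. Two facts make up for this.

  \<^item> Along a procyclic subgroup the difficulty disappears, because the group is commutative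
    (\<open>stabilizer_contains_procyclic\<close>). Let \<open>b \<in> H\<close> and let \<open>C\<close> be the closure of the group
    generated by \<open>b\<close>. For \<open>g \<in> C\<close> the identity \<open>c (b g) = c (g b)\<close> says
    \<open>(b - 1) c g = (g - 1) c b\<close>. If \<open>g\<close> lies in a small power of \<open>C\<close>, then \<open>g\<close> fixes the single vector
    \<open>c b\<close>, so \<open>b\<close> fixes \<open>c g\<close>, and so does all of \<open>C\<close>, as the stabilizer of \<open>c g\<close> is open, hence
    closed. So \<open>c\<close> is additive on the powers of \<open>g\<close>, and \<open>g ^ l\<close> fixes \<open>v\<close> for every \<open>l > 0\<close> that
    annihilates \<open>K\<close>. The \<open>l\<close>-th powers again contain a small power of \<open>C\<close>
    (\<open>closed_span_subset_powers\<close>); here \<open>l\<close> may or may not be divisible by \<open>p\<close>.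

  \<^item> A finitely generated powerful pro-\<open>p\<close> group is a product of finitely many procyclic
    subgroups, uniformly at all depths: if \<open>a\<^sub>1, \<dots>, a\<^sub>d\<close> are topological generators, the open
    subgroup \<open>P n\<close> of the lower \<open>p\<close>-series is contained in the product of the procyclic groups
    topologically generated by \<open>a\<^sub>i ^ (p ^ n)\<close>
    (\<open>lower_p_series_subset_procyclic_products\<close>). Hence a subgroup that contains some
    \<open>p\<close>-power of every procyclic subgroup is open (\<open>openin_subgroup_procyclicI\<close>).

  The second fact is the classical structure theory of powerful groups. It is carried out inside
  the topological group itself: the lower \<open>p\<close>-series is defined through closed subgroups, the
  computations take place modulo its terms, and compactness turns the resulting approximations
  into equalities. The point is that, in a powerful group, every element of
  \<open>P (k + 1)\<close> is a \<open>p\<close>-th power of an element of \<open>P k\<close> modulo \<open>P (k + 2)\<close>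
  (\<open>lower_p_series_Suc_subset_powers\<close>), and that the \<open>p\<close>-th power is a homomorphism between
  consecutive sections (\<open>pow_mult_modulo\<close>).
\<close>

section \<open>Commutators, quotients and products of powers in groups\<close>

text \<open>
  The commutator \<open>[x, u]\<close> is normalised such that \<open>u\<close> conjugates \<open>x\<close> to \<open>x [x, u]\<close>; membership
  of commutators in a subgroup is thus a statement about conjugates.
\<close>

definition commutator :: "('a, 'b) monoid_scheme \<Rightarrow> 'a \<Rightarrow> 'a \<Rightarrow> 'a" where
  "commutator G x u = inv\<^bsub>G\<^esub> x \<otimes>\<^bsub>G\<^esub> inv\<^bsub>G\<^esub> u \<otimes>\<^bsub>G\<^esub> x \<otimes>\<^bsub>G\<^esub> u"

lemma (in group) commutator_closed [simp, intro]:
  "x \<in> carrier G \<Longrightarrow> u \<in> carrier G \<Longrightarrow> commutator G x u \<in> carrier G"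
  by (simp add: commutator_def)

lemma (in group) mult_commutator:
  assumes "x \<in> carrier G" "u \<in> carrier G"
  shows "u \<otimes> x \<otimes> commutator G x u = x \<otimes> u"
    and "x \<otimes> commutator G x u = inv u \<otimes> x \<otimes> u"
proof -
  show c: "x \<otimes> commutator G x u = inv u \<otimes> x \<otimes> u"
    using assms by (simp add: commutator_def m_assoc[symmetric])
  show "u \<otimes> x \<otimes> commutator G x u = x \<otimes> u"
    using assms c by (simp add: m_assoc) (simp add: m_assoc[symmetric])
qed

lemma (in group) commutator_eq_one_iff:
  assumes "x \<in> carrier G" "u \<in> carrier G"
  shows "commutator G x u = \<one> \<longleftrightarrow> x \<otimes> u = u \<otimes> x"
  using assms mult_commutator(1)[OF assms] commutator_closed[OF assms]
  by (metis l_cancel_one' m_closed r_cancel_one)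

lemma (in group_hom) hom_commutator:
  assumes "x \<in> carrier G" "u \<in> carrier G"
  shows "h (commutator G x u) = commutator H (h x) (h u)"
  using assms by (simp add: commutator_def)

lemma (in group) subgroup_nat_pow:
  "subgroup S G \<Longrightarrow> x \<in> S \<Longrightarrow> x [^] (n::nat) \<in> S"
  by (induction n) (auto intro: subgroup.m_closed subgroup.one_closed)

lemma (in group) mult_left_cancel:
  assumes "x \<otimes> y = x \<otimes> z" "x \<in> carrier G" "y \<in> carrier G" "z \<in> carrier G"
  shows "y = z"
  using assms Units_l_cancel[of x y z] by (simp add: Units_eq)

lemma (in group) commutes_inv:
  assumes "x \<in> carrier G" "y \<in> carrier G" "x \<otimes> y = y \<otimes> x"
  shows "inv x \<otimes> y = y \<otimes> inv x"
proof -
  have "inv x \<otimes> y = inv x \<otimes> (y \<otimes> x) \<otimes> inv x" using assms(1,2) by (simp add: m_assoc)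
  also have "\<dots> = inv x \<otimes> (x \<otimes> y) \<otimes> inv x" by (simp only: assms(3))
  also have "\<dots> = y \<otimes> inv x" using assms(1,2) by (simp flip: m_assoc)
  finally show ?thesis .
qed

lemma (in group) commutes_mult:
  assumes [simp]: "x \<in> carrier G" "y \<in> carrier G" "g \<in> carrier G"
    and xg: "x \<otimes> g = g \<otimes> x" and yg: "y \<otimes> g = g \<otimes> y"
  shows "x \<otimes> y \<otimes> g = g \<otimes> (x \<otimes> y)"
proof -
  have "x \<otimes> y \<otimes> g = x \<otimes> g \<otimes> y" by (simp add: m_assoc yg)
  then show ?thesis by (simp add: xg m_assoc)
qed

lemma (in group) conjugate_pow:
  assumes "x \<in> carrier G" "u \<in> carrier G"
  shows "(inv u \<otimes> x \<otimes> u) [^] (n::nat) = inv u \<otimes> x [^] n \<otimes> u"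
proof (induction n)
  case (Suc n)
  have "(inv u \<otimes> x [^] n \<otimes> u) \<otimes> (inv u \<otimes> x \<otimes> u) = inv u \<otimes> x [^] n \<otimes> (u \<otimes> inv u) \<otimes> x \<otimes> u"
    using assms by (simp only: m_assoc m_closed inv_closed nat_pow_closed)
  then show ?case using assms Suc by (simp add: m_assoc)
qed (use assms in simp)

text \<open>
  Moving the \<open>n\<close> factors \<open>y\<close> to the left passes each of them over at most \<open>n - 1\<close> factors \<open>w\<close>, and
  every exchange leaves one central factor \<open>c\<close>; there is one exchange for each pair of positions.
\<close>

lemma (in group) mult_pow_central_commutator:
  assumes [simp]: "y \<in> carrier G" "w \<in> carrier G" "c \<in> carrier G"
    and wy: "w \<otimes> y = y \<otimes> w \<otimes> c"
    and cy: "c \<otimes> y = y \<otimes> c" and cw: "c \<otimes> w = w \<otimes> c"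
  shows "(y \<otimes> w) [^] (n::nat) = y [^] n \<otimes> w [^] n \<otimes> c [^] (n choose 2)"
proof -
  have cyn: "c [^] (k::nat) \<otimes> y = y \<otimes> c [^] k" for k
    using group_commutes_pow[OF cy] by simp
  have cwn: "c [^] (k::nat) \<otimes> w = w \<otimes> c [^] k" for k
    using group_commutes_pow[OF cw] by simp
  have cwn': "c [^] (k::nat) \<otimes> (w \<otimes> x) = w \<otimes> (c [^] k \<otimes> x)" if "x \<in> carrier G" for k x
    using cwn[of k] that by (simp flip: m_assoc)
  have wny: "w [^] (k::nat) \<otimes> y = y \<otimes> w [^] k \<otimes> c [^] k" for k
  proof (induction k)
    case (Suc k)
    have "w [^] Suc k \<otimes> y = w [^] k \<otimes> (w \<otimes> y)" by (simp add: m_assoc)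
    also have "\<dots> = (w [^] k \<otimes> y) \<otimes> (w \<otimes> c)" by (simp add: wy m_assoc)
    also have "\<dots> = y \<otimes> w [^] k \<otimes> (c [^] k \<otimes> w) \<otimes> c" by (simp add: Suc m_assoc)
    also have "\<dots> = y \<otimes> w [^] Suc k \<otimes> c [^] Suc k" by (simp add: cwn m_assoc)
    finally show ?case .
  qed simp
  show ?thesis
  proof (induction n)
    case (Suc n)
    have "(y \<otimes> w) [^] Suc n = y [^] n \<otimes> w [^] n \<otimes> (c [^] (n choose 2) \<otimes> y) \<otimes> w"
      by (simp add: Suc m_assoc)
    also have "\<dots> = y [^] n \<otimes> (w [^] n \<otimes> y) \<otimes> (c [^] (n choose 2) \<otimes> w)"
      by (simp add: cyn m_assoc)
    also have "\<dots> = y [^] n \<otimes> (y \<otimes> w [^] n) \<otimes> (c [^] n \<otimes> w) \<otimes> c [^] (n choose 2)"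
      by (simp add: wny cwn cwn' m_assoc)
    also have "\<dots> = y [^] Suc n \<otimes> w [^] Suc n \<otimes> (c [^] n \<otimes> c [^] (n choose 2))"
      by (simp add: cwn' m_assoc)
    also have "c [^] n \<otimes> c [^] (n choose 2) = c [^] (Suc n choose 2)"
      by (simp add: nat_pow_mult numeral_2_eq_2)
    finally show ?case .
  qed (simp add: numeral_2_eq_2)
qed

lemma (in group) mult_pow_eq:
  assumes "y \<in> carrier G" "w \<in> carrier G"
    and c: "\<And>g. g \<in> carrier G \<Longrightarrow> commutator G w y \<otimes> g = g \<otimes> commutator G w y"
    and "commutator G w y [^] (n choose 2) = \<one>"
  shows "(y \<otimes> w) [^] (n::nat) = y [^] n \<otimes> w [^] n"
  using mult_pow_central_commutator[of y w "commutator G w y" n] mult_commutator(1)[of w y] assms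
  by simp

text \<open>
  Congruences modulo a normal subgroup are computed as equations in the quotient group. As a rule
  these computations need only the kernel and the surjectivity of the quotient map, so the cosets
  are hidden.
\<close>

lemma (in normal) obtain_quotient_map:
  obtains R :: "'a set monoid" and h where "group_hom G R h"
    and "\<And>x. x \<in> carrier G \<Longrightarrow> h x = \<one>\<^bsub>R\<^esub> \<longleftrightarrow> x \<in> H"
    and "h ` carrier G = carrier R"
proof
  show "group_hom G (G Mod H) (\<lambda>a. H #> a)"
    by (intro group_hom.intro group_hom_axioms.intro factorgroup_is_group r_coset_hom_Mod is_group)
  show "H #> x = \<one>\<^bsub>G Mod H\<^esub> \<longleftrightarrow> x \<in> H" if "x \<in> carrier G" for x
    using that coset_join1[of H x] coset_join2[of x H] subgroup_axioms subset
    by (auto simp: FactGroup_def)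
  show "(\<lambda>a. H #> a) ` carrier G = carrier (G Mod H)"
    by (simp add: carrier_FactGroup)
qed

text \<open>
  The products \<open>a\<^sub>1 ^ (q n\<^sub>1) \<cdots> a\<^sub>d ^ (q n\<^sub>d)\<close> in the fixed order of the list, with exponents \<open>n\<^sub>i \<in> I\<close>.
  Natural exponents suffice, since negative powers are limits of positive ones in a profinite group.
\<close>

primrec power_products :: "('a, 'b) monoid_scheme \<Rightarrow> nat set \<Rightarrow> nat \<Rightarrow> 'a list \<Rightarrow> 'a set" where
  "power_products G I q [] = {\<one>\<^bsub>G\<^esub>}"
| "power_products G I q (a # as) =
     (\<lambda>(n, z). a [^]\<^bsub>G\<^esub> (q * n) \<otimes>\<^bsub>G\<^esub> z) ` (I \<times> power_products G I q as)"

lemma finite_power_products: "finite I \<Longrightarrow> finite (power_products G I q as)"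
  by (induction as) auto

context group
begin

lemma power_products_closed:
  "set as \<subseteq> carrier G \<Longrightarrow> power_products G I q as \<subseteq> carrier G"
  by (induction as) auto

lemma one_in_power_products: "0 \<in> I \<Longrightarrow> set as \<subseteq> carrier G \<Longrightarrow> \<one> \<in> power_products G I q as"
  by (induction as) (auto intro!: image_eqI[where x = "(0, \<one>)"])

lemma pow_in_power_products:
  "set as \<subseteq> carrier G \<Longrightarrow> a \<in> set as \<Longrightarrow> a [^] q \<in> power_products G UNIV q as"
proof (induction as)
  case (Cons b as)
  show ?case
  proof (cases "a = b")
    case True
    then show ?thesis using Cons.prems one_in_power_products[of UNIV as q]
      by (auto intro!: image_eqI[where x = "(1, \<one>)"])
  next
    case False
    then show ?thesis using Cons by (auto intro!: image_eqI[where x = "(0, a [^] q)"])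
  qed
qed simp

text \<open>
  When the factors \<open>a\<^sub>i ^ (q r)\<close> of the second product are central, they can be absorbed one by one
  into the corresponding factors of the first product.
\<close>

lemma power_products_mult:
  assumes "set as \<subseteq> carrier G"
    and "\<And>a x. a \<in> set as \<Longrightarrow> x \<in> carrier G \<Longrightarrow> a [^] (q * r) \<otimes> x = x \<otimes> a [^] (q * r)"
    and "c \<in> power_products G UNIV q as" "d \<in> power_products G UNIV (q * r) as"
  shows "c \<otimes> d \<in> power_products G UNIV q as"
  using assms
proof (induction as arbitrary: c d)
  case (Cons a as)
  then obtain n z m y where
    c: "c = a [^] (q * n) \<otimes> z" "z \<in> power_products G UNIV q as" and
    d: "d = a [^] (q * r * m) \<otimes> y" "y \<in> power_products G UNIV (q * r) as"
    by auto
  have [simp]: "a \<in> carrier G" "z \<in> carrier G" "y \<in> carrier G"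
    using Cons.prems(1) c d power_products_closed[of as] by auto
  have "a [^] (q * r * m) \<otimes> z = z \<otimes> a [^] (q * r * m)"
    using group_commutes_pow[of "a [^] (q * r)" z m] Cons.prems(2)[of a z] by (simp add: nat_pow_pow)
  then have "c \<otimes> d = a [^] (q * n) \<otimes> (a [^] (q * r * m) \<otimes> z) \<otimes> y"
    by (simp add: c d m_assoc)
  also have "\<dots> = a [^] (q * (n + r * m)) \<otimes> (z \<otimes> y)"
    by (simp add: m_assoc[symmetric] nat_pow_mult algebra_simps)
  finally show ?case using Cons.IH[OF _ _ c(2) d(2)] Cons.prems
    by (auto intro!: image_eqI[where x = "(n + r * m, z \<otimes> y)"])
qed simp

lemma power_products_reduce:
  assumes "set as \<subseteq> carrier G" "\<And>a. a \<in> set as \<Longrightarrow> a [^] (q * p) = \<one>" "p > 0"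
  shows "power_products G UNIV q as \<subseteq> power_products G {..<p} q as"
  using assms
proof (induction as)
  case (Cons a as)
  have "a [^] (q * n) = a [^] (q * (n mod p))" for n
  proof -
    have "a [^] (q * n) = (a [^] (q * p)) [^] (n div p) \<otimes> a [^] (q * (n mod p))"
    proof -
      have "q * n = q * p * (n div p) + q * (n mod p)"
        by (metis distrib_left mult.assoc mult_div_mod_eq)
      then show ?thesis using Cons.prems(1) by (simp add: nat_pow_pow nat_pow_mult)
    qed
    then show ?thesis using Cons.prems by simp
  qed
  with Cons show ?case
    by (auto intro!: image_eqI[where x = "(n mod p, z)" for n z])
qed simp

lemma power_products_pow:
  assumes "set as \<subseteq> carrier G" "subgroup M G" "\<And>a. a \<in> set as \<Longrightarrow> a [^] q \<in> M"
    and mult: "\<And>x y. x \<in> M \<Longrightarrow> y \<in> M \<Longrightarrow> (x \<otimes> y) [^] p = x [^] p \<otimes> y [^] (p::nat)"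
    and "c \<in> power_products G UNIV q as"
  shows "c \<in> M \<and> c [^] p \<in> power_products G UNIV (q * p) as"
  using assms(1,3,5)
proof (induction as arbitrary: c)
  case Nil
  then show ?case using subgroup.one_closed[OF assms(2)] by simp
next
  case (Cons a as)
  then obtain n z where c: "c = a [^] (q * n) \<otimes> z" "z \<in> power_products G UNIV q as"
    by auto
  have [simp]: "a \<in> carrier G" using Cons by simp
  have z: "z \<in> M" "z [^] p \<in> power_products G UNIV (q * p) as"
    using Cons c by auto
  have "(a [^] q) [^] n \<in> M"
    using Cons.prems(2)[of a] assms(2) by (simp add: subgroup_nat_pow)
  then have a: "a [^] (q * n) \<in> M" by (simp add: nat_pow_pow)
  have "c [^] p = a [^] (q * p * n) \<otimes> z [^] p"
    using mult[OF a z(1)] by (simp add: c nat_pow_pow mult_ac)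
  then show ?case using a z assms(2) c
    by (auto intro!: subgroup.m_closed image_eqI[where x = "(n, z [^] p)"])
qed

end

lemma (in group_hom) image_power_products:
  assumes "set as \<subseteq> carrier G"
  shows "h ` power_products G I q as = power_products H I q (map h as)"
  using assms
proof (induction as)
  case (Cons a as)
  have sub: "power_products G I q as \<subseteq> carrier G"
    using Cons.prems G.power_products_closed by simp
  have "h ` power_products G I q (a # as) =
      (\<lambda>(n, z). h a [^]\<^bsub>H\<^esub> (q * n) \<otimes>\<^bsub>H\<^esub> h z) ` (I \<times> power_products G I q as)"
    unfolding power_products.simps image_image
    by (rule image_cong) (use sub Cons.prems in \<open>auto simp: hom_nat_pow subset_iff\<close>)
  also have "\<dots> = (\<lambda>(n, z). h a [^]\<^bsub>H\<^esub> (q * n) \<otimes>\<^bsub>H\<^esub> z) ` (I \<times> h ` power_products G I q as)"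
    by force
  finally show ?case using Cons by simp
qed simp

text \<open>
  The class equation: conjugacy classes of more than one element have order divisible by \<open>p\<close>, so the
  identity cannot be the only element that forms a class by itself. A suitable power of a
  nontrivial central element has order \<open>p\<close>.
\<close>

lemma (in group) prime_power_order_center:
  fixes p :: nat
  assumes p: "Factorial_Ring.prime p" and ord: "order G = p ^ m" and "m > 0"
  obtains z where "z \<in> carrier G" "z \<noteq> \<one>" "z [^] p = \<one>"
    "\<And>g. g \<in> carrier G \<Longrightarrow> z \<otimes> g = g \<otimes> z"
proof -
  have fin: "finite (carrier G)"
    using ord p order_gt_0_iff_finite by (simp add: prime_gt_0_nat)
  define \<phi> where "\<phi> = (\<lambda>g. \<lambda>h\<in>carrier G. g \<otimes> h \<otimes> inv g)"
  interpret A: group_action G "carrier G" \<phi>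
    unfolding \<phi>_def by (rule action_by_conjugation)
  have orb: "orbit G \<phi> x = {g \<otimes> x \<otimes> inv g | g. g \<in> carrier G}" if "x \<in> carrier G" for x
    using that by (simp add: orbit_def \<phi>_def)
  have central: "x \<otimes> g = g \<otimes> x" if x: "x \<in> carrier G" and g: "g \<in> carrier G"
    and card: "card (orbit G \<phi> x) = 1" for x g
  proof -
    have "x \<in> orbit G \<phi> x" "g \<otimes> x \<otimes> inv g \<in> orbit G \<phi> x"
      using A.orbit_refl x g by (auto simp: orb)
    then have "g \<otimes> x \<otimes> inv g = x"
      using card by (metis card_1_singletonE singletonD)
    then show ?thesis using x g by (metis inv_solve_right' m_closed)
  qed
  have "\<exists>y \<in> carrier G. y \<noteq> \<one> \<and> card (orbit G \<phi> y) = 1"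
  proof (rule ccontr)
    assume no: "\<not> ?thesis"
    have dvd: "p dvd card (orbit G \<phi> x)" if "x \<in> carrier G" "x \<noteq> \<one>" for x
    proof -
      have "card (orbit G \<phi> x) dvd p ^ m"
        using A.orbit_stabilizer_theorem[OF that(1)] ord by (metis dvd_triv_left)
      then obtain j where "card (orbit G \<phi> x) = p ^ j"
        using divides_primepow_nat[OF p] by blast
      moreover have "j \<noteq> 0" using calculation no that by auto
      ultimately show ?thesis by simp
    qed
    have o1: "orbit G \<phi> \<one> = {\<one>}" by (auto simp: orb intro!: exI[of _ "\<one>"])
    then have in1: "{\<one>} \<in> orbits G (carrier G) \<phi>"
      unfolding orbits_def using one_closed by (metis (mono_tags, lifting) mem_Collect_eq)
    have fino: "finite (orbits G (carrier G) \<phi>)"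
      using fin by (auto simp: orbits_def)
    have "p ^ m = (\<Sum>B\<in>orbits G (carrier G) \<phi>. card B)"
      using A.disjoint_sum[OF fin, of "\<lambda>_. 1 :: nat"] ord by (simp add: order_def)
    also have "\<dots> = 1 + (\<Sum>B\<in>orbits G (carrier G) \<phi> - {{\<one>}}. card B)"
      using sum.remove[OF fino in1, of card] by simp
    finally have "p ^ m = 1 + (\<Sum>B\<in>orbits G (carrier G) \<phi> - {{\<one>}}. card B)" .
    moreover have "p dvd (\<Sum>B\<in>orbits G (carrier G) \<phi> - {{\<one>}}. card B)"
      using dvd o1 by (intro dvd_sum) (auto simp: orbits_def)
    moreover have "p dvd p ^ m" using \<open>m > 0\<close> by (simp add: dvd_power)
    ultimately have "p dvd 1" by (metis dvd_add_left_iff)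
    then show False using p by (metis not_prime_unit)
  qed
  then obtain y where y: "y \<in> carrier G" "y \<noteq> \<one>" "card (orbit G \<phi> y) = 1" by blast
  have ex: "y [^] (p ^ m) = \<one>" using pow_order_eq_1[OF y(1)] ord by simp
  define j where "j = (LEAST j. y [^] (p ^ j) = \<one>)"
  have j: "y [^] (p ^ j) = \<one>" unfolding j_def using ex by (rule LeastI)
  then have "j \<noteq> 0" using y by (intro notI) simp
  then obtain i where i: "j = Suc i" using not0_implies_Suc by blast
  show thesis
  proof
    show "y [^] (p ^ i) \<in> carrier G" using y by simp
    show "y [^] (p ^ i) \<noteq> \<one>" using not_less_Least[of i "\<lambda>j. y [^] (p ^ j) = \<one>"] i
      unfolding j_def by simp
    show "(y [^] (p ^ i)) [^] p = \<one>" using j y i by (simp add: nat_pow_pow mult.commute)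
    show "y [^] (p ^ i) \<otimes> g = g \<otimes> y [^] (p ^ i)" if "g \<in> carrier G" for g
      using group_commutes_pow central y that by simp
  qed
qed

text \<open>
  This is the preimage of the centre of the quotient by \<open>H\<close>.
\<close>

lemma (in normal) subgroup_central_modulo:
  "subgroup {x \<in> carrier G. \<forall>u\<in>carrier G. commutator G x u \<in> H} G"
proof -
  obtain R :: "'a set monoid" and h where "group_hom G R h"
    and h1: "\<And>x. x \<in> carrier G \<Longrightarrow> h x = \<one>\<^bsub>R\<^esub> \<longleftrightarrow> x \<in> H"
    using obtain_quotient_map by metis
  interpret h: group_hom G R h by fact
  have eq: "commutator G x u \<in> H \<longleftrightarrow> h x \<otimes>\<^bsub>R\<^esub> h u = h u \<otimes>\<^bsub>R\<^esub> h x"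
    if "x \<in> carrier G" "u \<in> carrier G" for x u
    using that h1[of "commutator G x u"] h.H.commutator_eq_one_iff[of "h x" "h u"]
    by (simp add: h.hom_commutator)
  let ?Z = "{x \<in> carrier G. \<forall>u\<in>carrier G. commutator G x u \<in> H}"
  have Z: "x \<in> ?Z \<longleftrightarrow> x \<in> carrier G \<and> (\<forall>u\<in>carrier G. h x \<otimes>\<^bsub>R\<^esub> h u = h u \<otimes>\<^bsub>R\<^esub> h x)" for x
    using eq by blast
  show ?thesis
  proof
    fix x y assume xy: "x \<in> ?Z" "y \<in> ?Z"
    then have c: "x \<in> carrier G" "y \<in> carrier G" by blast+
    have "h x \<otimes>\<^bsub>R\<^esub> h y \<otimes>\<^bsub>R\<^esub> h u = h u \<otimes>\<^bsub>R\<^esub> (h x \<otimes>\<^bsub>R\<^esub> h y)" if "u \<in> carrier G" for u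
      using xy[unfolded Z] that by (intro h.H.commutes_mult) auto
    then show "x \<otimes> y \<in> ?Z" using c unfolding Z by simp
  next
    fix x assume x: "x \<in> ?Z"
    then have c: "x \<in> carrier G" by blast
    have "inv\<^bsub>R\<^esub> h x \<otimes>\<^bsub>R\<^esub> h u = h u \<otimes>\<^bsub>R\<^esub> inv\<^bsub>R\<^esub> h x" if "u \<in> carrier G" for u
      using x[unfolded Z] that by (intro h.H.commutes_inv) auto
    then show "inv x \<in> ?Z" using c unfolding Z by simp
  qed (auto simp: eq)
qed

section \<open>Closed and open subgroups of topological groups\<close>

context topological_group
begin

lemma continuous_map_times [continuous_intros]:
  assumes "continuous_map X T f" "continuous_map X T g"
  shows "continuous_map X T (\<lambda>x. f x \<otimes> g x)"
  using continuous_map_compose[OF continuous_map_pairedI[OF assms] continuous_mult]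
  by (simp add: o_def)

lemma continuous_map_inverse [continuous_intros]:
  assumes "continuous_map X T f"
  shows "continuous_map X T (\<lambda>x. inv (f x))"
  using continuous_map_compose[OF assms continuous_inv] by (simp add: o_def)

lemma continuous_map_carrier_const:
  "a \<in> carrier G \<Longrightarrow> continuous_map X T (\<lambda>_. a)"
  by (simp add: topspace_eq)

lemma continuous_map_nat_pow [continuous_intros]:
  assumes "continuous_map X T f"
  shows "continuous_map X T (\<lambda>x. f x [^] (n::nat))"
proof (induction n)
  case 0
  then show ?case using continuous_map_carrier_const[of \<one>] by simp
qed (simp add: continuous_map_times assms)

lemma continuous_map_commutator [continuous_intros]:
  assumes "continuous_map X T f" "continuous_map X T g"
  shows "continuous_map X T (\<lambda>x. commutator G (f x) (g x))"
  unfolding commutator_def by (intro continuous_intros assms)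

lemma openin_carrier: "openin T (carrier G)"
  using topspace_eq openin_topspace by metis

lemma openin_translate:
  assumes "openin T W" "a \<in> carrier G"
  shows "openin T {x \<in> carrier G. a \<otimes> x \<in> W}"
proof -
  have "continuous_map T T (\<lambda>x. a \<otimes> x)"
    using assms by (auto intro!: continuous_map_times continuous_map_carrier_const)
  from openin_continuous_map_preimage[OF this assms(1)] show ?thesis by (simp add: topspace_eq)
qed

lemma closedin_translate:
  assumes "closedin T W" "a \<in> carrier G"
  shows "closedin T {x \<in> carrier G. a \<otimes> x \<in> W}"
proof -
  have "continuous_map T T (\<lambda>x. a \<otimes> x)"
    using assms by (auto intro!: continuous_map_times continuous_map_carrier_const)
  from closedin_continuous_map_preimage[OF this assms(1)] show ?thesis by (simp add: topspace_eq)
qed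

lemma openin_subgroupI:
  assumes S: "subgroup S G" and W: "openin T W" "\<one> \<in> W" "W \<subseteq> S"
  shows "openin T S"
proof (subst openin_subopen, intro ballI)
  fix y assume y: "y \<in> S"
  have yc: "y \<in> carrier G" using S y by (rule subgroup.mem_carrier)
  have "{x \<in> carrier G. inv y \<otimes> x \<in> W} \<subseteq> S"
  proof clarify
    fix x assume x: "x \<in> carrier G" "inv y \<otimes> x \<in> W"
    then have "y \<otimes> (inv y \<otimes> x) \<in> S" using y W S by (blast intro: subgroup.m_closed)
    then show "x \<in> S" using x yc by (simp flip: m_assoc)
  qed
  then show "\<exists>V. openin T V \<and> y \<in> V \<and> V \<subseteq> S"
    using openin_translate[OF W(1), of "inv y"] yc W(2) by auto
qed

lemma closedin_open_subgroup:
  assumes S: "subgroup S G" "openin T S"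
  shows "closedin T S"
proof -
  have "openin T (carrier G - S)"
  proof (subst openin_subopen, intro ballI)
    fix y assume y: "y \<in> carrier G - S"
    have "{x \<in> carrier G. inv y \<otimes> x \<in> S} \<subseteq> carrier G - S"
    proof clarify
      fix x assume x: "x \<in> carrier G" "inv y \<otimes> x \<in> S" "x \<in> S"
      then have "inv y \<otimes> x \<otimes> inv x \<in> S" using S by (blast intro: subgroup.m_closed subgroup.m_inv_closed)
      then have "inv y \<in> S" using x y by (simp add: m_assoc)
      then have "inv (inv y) \<in> S" by (rule subgroup.m_inv_closed[OF S(1)])
      then show False using y by simp
    qed
    then show "\<exists>V. openin T V \<and> y \<in> V \<and> V \<subseteq> carrier G - S"
      using openin_translate[OF S(2), of "inv y"] y subgroup.one_closed[OF S(1)] by auto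
  qed
  then show ?thesis using subgroup.subset[OF S(1)] by (simp add: closedin_def topspace_eq)
qed

lemma subgroup_closure:
  assumes S: "subgroup S G"
  shows "subgroup (T closure_of S) G"
proof
  show "T closure_of S \<subseteq> carrier G"
    using closure_of_subset_topspace[of T S] topspace_eq by simp
  fix x y assume "x \<in> T closure_of S" "y \<in> T closure_of S"
  then have "(x, y) \<in> prod_topology T T closure_of (S \<times> S)"
    by (simp add: closure_of_Times)
  then have "x \<otimes> y \<in> T closure_of ((\<lambda>(x, y). x \<otimes> y) ` (S \<times> S))"
    using continuous_map_image_closure_subset[OF continuous_mult, of "S \<times> S"] by force
  also have "\<dots> \<subseteq> T closure_of S"
    using S by (intro closure_of_mono) (auto intro: subgroup.m_closed)
  finally show "x \<otimes> y \<in> T closure_of S" .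
next
  show "\<one> \<in> T closure_of S"
    using closure_of_subset[of S T] S subgroup.one_closed subgroup.subset topspace_eq by blast
  fix x assume "x \<in> T closure_of S"
  then have "inv x \<in> T closure_of ((\<lambda>x. inv x) ` S)"
    using continuous_map_image_closure_subset[OF continuous_inv, of S] by blast
  also have "\<dots> \<subseteq> T closure_of S"
    using S by (intro closure_of_mono) (auto intro: subgroup.m_inv_closed)
  finally show "inv x \<in> T closure_of S" .
qed

lemma normal_closure:
  assumes "N \<lhd> G"
  shows "T closure_of N \<lhd> G"
  unfolding normal_inv_iff
proof (intro conjI ballI)
  show "subgroup (T closure_of N) G"
    using assms by (intro subgroup_closure normal_imp_subgroup)
  fix g x assume g: "g \<in> carrier G" and x: "x \<in> T closure_of N"
  have "continuous_map T T (\<lambda>x. g \<otimes> x \<otimes> inv g)"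
    using g by (auto intro!: continuous_map_times continuous_map_carrier_const)
  from continuous_map_image_closure_subset[OF this, of N] x
  have "g \<otimes> x \<otimes> inv g \<in> T closure_of ((\<lambda>x. g \<otimes> x \<otimes> inv g) ` N)" by blast
  also have "\<dots> \<subseteq> T closure_of N"
    using assms g by (intro closure_of_mono) (auto simp: normal_inv_iff)
  finally show "g \<otimes> x \<otimes> inv g \<in> T closure_of N" .
qed

definition closed_span :: "'a set \<Rightarrow> 'a set" where
  "closed_span X = T closure_of generate G X"

lemma closed_span:
  assumes "X \<subseteq> carrier G"
  shows subgroup_closed_span: "subgroup (closed_span X) G"
    and closedin_closed_span: "closedin T (closed_span X)"
    and subset_closed_span: "X \<subseteq> closed_span X"
proof -
  have g: "subgroup (generate G X) G" by (rule generate_is_subgroup) fact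
  then show "subgroup (closed_span X) G"
    unfolding closed_span_def by (rule subgroup_closure)
  show "closedin T (closed_span X)" by (simp add: closed_span_def)
  have "X \<subseteq> generate G X" by (auto intro: generate.incl)
  also have "\<dots> \<subseteq> closed_span X"
    unfolding closed_span_def
    using g by (intro closure_of_subset) (simp add: topspace_eq subgroup.subset)
  finally show "X \<subseteq> closed_span X" .
qed

lemma closed_span_minimal:
  assumes "subgroup S G" "closedin T S" "X \<subseteq> S"
  shows "closed_span X \<subseteq> S"
  unfolding closed_span_def
  using assms generate_subgroup_incl[of X S] by (intro closure_of_minimal)

lemma closedin_central_modulo:
  assumes "closedin T L"
  shows "closedin T {x \<in> carrier G. \<forall>u\<in>carrier G. commutator G x u \<in> L}"
proof -
  have "closedin T {x \<in> carrier G. commutator G x u \<in> L}" if "u \<in> carrier G" for u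
  proof -
    have "continuous_map T T (\<lambda>x. commutator G x u)"
      using that by (auto intro!: continuous_map_commutator continuous_map_carrier_const)
    from closedin_continuous_map_preimage[OF this assms] show ?thesis by (simp add: topspace_eq)
  qed
  then have "closedin T (\<Inter>u\<in>carrier G. {x \<in> carrier G. commutator G x u \<in> L})"
    by (intro closedin_INT) (use one_closed in blast)+
  moreover have "(\<Inter>u\<in>carrier G. {x \<in> carrier G. commutator G x u \<in> L})
      = {x \<in> carrier G. \<forall>u\<in>carrier G. commutator G x u \<in> L}"
    using one_closed by blast
  ultimately show ?thesis by simp
qed

lemma compactin_times_image:
  assumes "compactin T A" "compactin T B"
  shows "compactin T ((\<lambda>(x, y). x \<otimes> y) ` (A \<times> B))"
  using image_compactin[OF _ continuous_mult, of "A \<times> B"] assms by (simp add: compactin_Times)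

lemma closedin_finite_preimage:
  assumes "group_hom G R h" and ker: "\<And>x. x \<in> carrier G \<Longrightarrow> h x = \<one>\<^bsub>R\<^esub> \<longleftrightarrow> x \<in> L"
    and "closedin T L" "finite F"
  shows "closedin T {x \<in> carrier G. h x \<in> F}"
proof -
  interpret h: group_hom G R h by fact
  have "closedin T {x \<in> carrier G. h x = f}" for f
  proof (cases "\<exists>y\<in>carrier G. h y = f")
    case True
    then obtain y where y: "y \<in> carrier G" "h y = f" by blast
    have "h x = f \<longleftrightarrow> inv y \<otimes> x \<in> L" if "x \<in> carrier G" for x
      using that y ker[of "inv y \<otimes> x"] h.H.inv_solve_left'[of "\<one>\<^bsub>R\<^esub>" "h y" "h x"] by auto
    then have "{x \<in> carrier G. h x = f} = {x \<in> carrier G. inv y \<otimes> x \<in> L}" by blast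
    then show ?thesis using closedin_translate[OF assms(3), of "inv y"] y by simp
  next
    case False
    then have "{x \<in> carrier G. h x = f} = {}" by blast
    then show ?thesis by (simp only: closedin_empty)
  qed
  then have "closedin T (\<Union>f\<in>F. {x \<in> carrier G. h x = f})"
    using \<open>finite F\<close> by (intro closedin_Union) auto
  moreover have "(\<Union>f\<in>F. {x \<in> carrier G. h x = f}) = {x \<in> carrier G. h x \<in> F}" by blast
  ultimately show ?thesis by simp
qed

end

section \<open>The lower p-series of a pro-p group\<close>

locale pro_p = topological_group G T for G (structure) and T +
  fixes p :: nat
  assumes prime_p: "Factorial_Ring.prime p" and pro_p: "pro_p_group p G T"
begin

lemma compact: "compact_space T" and Hausdorff: "Hausdorff_space T"
  using pro_p by (auto simp: pro_p_group_def profinite_group_def)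

lemma closedin_imp_compactin: "closedin T S \<Longrightarrow> compactin T S"
  using closedin_compact_space compact by blast

lemma p_pos: "p > 0" using prime_p by (simp add: prime_gt_0_nat)

text \<open>
  Compactness gives, by the tube lemma, a neighbourhood of the identity all of whose conjugates lie
  in a given open subgroup; so the normal core of an open subgroup is again open.
\<close>

lemma normal_core_open:
  assumes W: "openin T W" "\<one> \<in> W"
  obtains N where "N \<lhd> G" "openin T N" "N \<subseteq> W"
proof -
  obtain H where H: "subgroup H G" "openin T H" "H \<subseteq> W"
    using pro_p W unfolding pro_p_group_def profinite_group_def by blast
  interpret H: subgroup H G by fact
  define N where "N = {g \<in> carrier G. \<forall>u\<in>carrier G. u \<otimes> g \<otimes> inv u \<in> H}"
  have mult: "u \<otimes> (x \<otimes> y) \<otimes> inv u = (u \<otimes> x \<otimes> inv u) \<otimes> (u \<otimes> y \<otimes> inv u)"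
    if "u \<in> carrier G" "x \<in> carrier G" "y \<in> carrier G" for u x y
  proof -
    have "(u \<otimes> x \<otimes> inv u) \<otimes> (u \<otimes> y \<otimes> inv u) = u \<otimes> x \<otimes> (inv u \<otimes> u) \<otimes> y \<otimes> inv u"
      using that by (simp only: m_assoc m_closed inv_closed)
    then show ?thesis using that by (simp add: m_assoc)
  qed
  have N: "N \<lhd> G"
    unfolding normal_inv_iff
  proof (intro conjI ballI)
    show "subgroup N G"
    proof
      fix x assume x: "x \<in> N"
      have "u \<otimes> inv x \<otimes> inv u \<in> H" if u: "u \<in> carrier G" for u
      proof -
        have "inv (u \<otimes> x \<otimes> inv u) \<in> H" using x u by (auto simp: N_def)
        then show ?thesis using x u by (simp add: N_def inv_mult_group m_assoc)
      qed
      then show "inv x \<in> N" using x by (simp add: N_def)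
    qed (auto simp: N_def mult)
    fix g x assume g: "g \<in> carrier G" and x: "x \<in> N"
    have "u \<otimes> (g \<otimes> x \<otimes> inv g) \<otimes> inv u \<in> H" if u: "u \<in> carrier G" for u
    proof -
      have "(u \<otimes> g) \<otimes> x \<otimes> inv (u \<otimes> g) \<in> H" using x g u by (simp add: N_def)
      then show ?thesis using x g u by (simp add: N_def inv_mult_group m_assoc)
    qed
    then show "g \<otimes> x \<otimes> inv g \<in> N" using g x by (simp add: N_def)
  qed
  have "continuous_map (prod_topology T T) T (\<lambda>z. fst z \<otimes> snd z \<otimes> inv (fst z))"
    by (intro continuous_intros)
  from openin_continuous_map_preimage[OF this H(2)]
  have "openin (prod_topology T T) {z \<in> carrier G \<times> carrier G. fst z \<otimes> snd z \<otimes> inv (fst z) \<in> H}"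
    by (simp add: topspace_eq)
  moreover have "compactin T (carrier G)" using compact by (simp add: compact_space_def topspace_eq)
  ultimately have "\<exists>U V. openin T U \<and> openin T V \<and> carrier G \<subseteq> U \<and> \<one> \<in> V \<and>
      U \<times> V \<subseteq> {z \<in> carrier G \<times> carrier G. fst z \<otimes> snd z \<otimes> inv (fst z) \<in> H}"
    by (intro tube_lemma_left) (auto simp: topspace_eq)
  then obtain U V where UV: "openin T V" "\<one> \<in> V" "carrier G \<subseteq> U"
     "U \<times> V \<subseteq> {z \<in> carrier G \<times> carrier G. fst z \<otimes> snd z \<otimes> inv (fst z) \<in> H}"
    by blast
  have "V \<subseteq> N"
  proof
    fix v assume v: "v \<in> V"
    then have "u \<otimes> v \<otimes> inv u \<in> H \<and> v \<in> carrier G" if "u \<in> carrier G" for u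
      using UV(3,4) that by force
    then show "v \<in> N" unfolding N_def using one_closed by blast
  qed
  then have "openin T N"
    using openin_subgroupI[OF normal_imp_subgroup[OF N] UV(1,2)] by simp
  moreover have "N \<subseteq> W"
  proof
    fix x assume "x \<in> N"
    then have "x \<in> carrier G" "\<one> \<otimes> x \<otimes> inv \<one> \<in> H" unfolding N_def using one_closed by blast+
    then show "x \<in> W" using H(3) by auto
  qed
  ultimately show thesis using N that by blast
qed

text \<open>
  The closed lower central \<open>p\<close>-series: \<open>P (k + 1)\<close> is the least closed subgroup that makes
  \<open>P k / P (k + 1)\<close> a central section of exponent \<open>p\<close>.
\<close>

primrec lower_p_series :: "nat \<Rightarrow> 'a set" where
  "lower_p_series 0 = carrier G"
| "lower_p_series (Suc k) = closed_span
     ((\<lambda>x. x [^] p) ` lower_p_series k \<union> (\<lambda>(x, u). commutator G x u) ` (lower_p_series k \<times> carrier G))"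

abbreviation "P \<equiv> lower_p_series"

lemma lower_p_series_subset: "P k \<subseteq> carrier G"
proof (induction k)
  case (Suc k)
  show ?case unfolding lower_p_series.simps
    by (rule subgroup.subset, rule subgroup_closed_span) (use Suc in auto)
qed simp

lemma lower_p_series_carrier: "x \<in> P k \<Longrightarrow> x \<in> carrier G"
  using lower_p_series_subset by blast

lemma lower_p_series_gens:
  "(\<lambda>x. x [^] p) ` P k \<union> (\<lambda>(x, u). commutator G x u) ` (P k \<times> carrier G) \<subseteq> carrier G"
  using lower_p_series_carrier by auto

lemma subgroup_lower_p_series: "subgroup (P k) G"
  by (cases k) (simp_all add: subgroup_self subgroup_closed_span[OF lower_p_series_gens])

lemma closedin_lower_p_series: "closedin T (P k)"
proof (cases k)
  case 0 then show ?thesis using closedin_topspace[of T] topspace_eq by simp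
qed (simp add: closedin_closed_span[OF lower_p_series_gens])

lemma pow_in_lower_p_series: "x \<in> P k \<Longrightarrow> x [^] p \<in> P (Suc k)"
  and commutator_in_lower_p_series: "x \<in> P k \<Longrightarrow> u \<in> carrier G \<Longrightarrow> commutator G x u \<in> P (Suc k)"
  using subset_closed_span[OF lower_p_series_gens, of k] by auto

lemma lower_p_series_Suc_subsetI:
  assumes "subgroup S G" "closedin T S" "\<And>x. x \<in> P k \<Longrightarrow> x [^] p \<in> S"
    and "\<And>x u. x \<in> P k \<Longrightarrow> u \<in> carrier G \<Longrightarrow> commutator G x u \<in> S"
  shows "P (Suc k) \<subseteq> S"
  unfolding lower_p_series.simps by (rule closed_span_minimal) (use assms in auto)

text \<open>
  From here on \<open>P (k + 1)\<close> is used only through its generators and its minimality.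
\<close>

declare lower_p_series.simps(2) [simp del]

text \<open>
  Normality of \<open>P (k + 1)\<close> is automatic once \<open>P (k + 1) \<subseteq> P k\<close>: the conjugates of \<open>x \<in> P (k + 1)\<close>
  are \<open>x [x, u]\<close>, and \<open>[x, u]\<close> with \<open>x \<in> P k\<close> is one of the generators. Both properties are
  therefore proved together.
\<close>

lemma normal_lower_p_series: "P k \<lhd> G"
  and lower_p_series_Suc_subset: "P (Suc k) \<subseteq> P k"
proof -
  have "P k \<lhd> G \<and> P (Suc k) \<subseteq> P k"
  proof (induction k)
    case 0
    have "carrier G \<lhd> G" by (simp add: normal_inv_iff subgroup_self)
    then show ?case using lower_p_series_subset[of "Suc 0"] by simp
  next
    case (Suc k)
    have N: "P (Suc k) \<lhd> G"
      unfolding normal_inv_iff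
    proof (intro conjI ballI subgroup_lower_p_series)
      fix u x assume u: "u \<in> carrier G" and x: "x \<in> P (Suc k)"
      then have "x \<otimes> commutator G x (inv u) \<in> P (Suc k)"
        using Suc commutator_in_lower_p_series subgroup.m_closed[OF subgroup_lower_p_series] by blast
      then show "u \<otimes> x \<otimes> inv u \<in> P (Suc k)"
        using mult_commutator(2)[of x "inv u"] u lower_p_series_carrier[OF x] by simp
    qed
    have "P (Suc (Suc k)) \<subseteq> P (Suc k)"
    proof (rule lower_p_series_Suc_subsetI[OF subgroup_lower_p_series closedin_lower_p_series])
      fix x assume x: "x \<in> P (Suc k)"
      then show "x [^] p \<in> P (Suc k)" using Suc pow_in_lower_p_series by blast
      fix u assume "u \<in> carrier G"
      then show "commutator G x u \<in> P (Suc k)" using x Suc commutator_in_lower_p_series by blast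
    qed
    with N show ?case by blast
  qed
  then show "P k \<lhd> G" "P (Suc k) \<subseteq> P k" by auto
qed

lemma lower_p_series_antimono: "k \<le> l \<Longrightarrow> P l \<subseteq> P k"
  by (rule lift_Suc_antimono_le) (rule lower_p_series_Suc_subset)

lemma pow_prime_power_in_lower_p_series: "a \<in> carrier G \<Longrightarrow> a [^] (p ^ k) \<in> P k"
proof (induction k)
  case (Suc k)
  then have "(a [^] (p ^ k)) [^] p \<in> P (Suc k)" by (intro pow_in_lower_p_series) 
  then show ?case using Suc by (simp add: nat_pow_pow mult.commute)
qed simp

lemma obtain_lower_p_series_quotient:
  obtains R :: "'a set monoid" and h where "group_hom G R h"
    and "\<And>x. x \<in> carrier G \<Longrightarrow> h x = \<one>\<^bsub>R\<^esub> \<longleftrightarrow> x \<in> P (Suc k)"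
    and "h ` carrier G = carrier R"
    and "\<And>x. x \<in> P k \<Longrightarrow> h x [^]\<^bsub>R\<^esub> p = \<one>\<^bsub>R\<^esub>"
    and "\<And>x g. x \<in> P k \<Longrightarrow> g \<in> carrier R \<Longrightarrow> h x \<otimes>\<^bsub>R\<^esub> g = g \<otimes>\<^bsub>R\<^esub> h x"
proof -
  obtain R :: "'a set monoid" and h where hom: "group_hom G R h"
    and h1: "\<And>x. x \<in> carrier G \<Longrightarrow> h x = \<one>\<^bsub>R\<^esub> \<longleftrightarrow> x \<in> P (Suc k)"
    and surj: "h ` carrier G = carrier R"
    using normal.obtain_quotient_map[OF normal_lower_p_series[of "Suc k"]] by metis
  interpret h: group_hom G R h by fact
  show thesis
  proof (rule that[OF hom h1 surj])
    fix x assume x: "x \<in> P k"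
    have xc: "x \<in> carrier G" using x by (rule lower_p_series_carrier)
    show "h x [^]\<^bsub>R\<^esub> p = \<one>\<^bsub>R\<^esub>"
      using pow_in_lower_p_series[OF x] h1[of "x [^] p"] xc by (simp add: h.hom_nat_pow)
    fix g assume "g \<in> carrier R"
    then obtain u where u: "u \<in> carrier G" "g = h u" using surj by blast
    then show "h x \<otimes>\<^bsub>R\<^esub> g = g \<otimes>\<^bsub>R\<^esub> h x"
      using commutator_in_lower_p_series[OF x u(1)] h1[of "commutator G x u"] xc
        h.H.commutator_eq_one_iff[of "h x" "h u"] by (simp add: h.hom_commutator)
  qed
qed

text \<open>
  The lower \<open>p\<close>-series of the finite \<open>p\<close>-group \<open>G / N\<close> reaches the identity. By induction on the index:
  if \<open>N\<close> is proper, the elements that are central of order dividing \<open>p\<close> modulo \<open>N\<close> form a strictly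
  larger normal subgroup \<open>M\<close>, and \<open>P k \<subseteq> M\<close> forces \<open>P (k + 1) \<subseteq> N\<close>.
\<close>

lemma normal_open_contains_lower_p_series:
  assumes "N \<lhd> G" "openin T N"
  shows "\<exists>k. P k \<subseteq> N"
  using assms
proof (induction "card (rcosets N)" arbitrary: N rule: less_induct)
  case (less N)
  interpret N: normal N G by fact
  obtain m where m: "card (rcosets N) = p ^ m"
    using pro_p less.prems unfolding pro_p_group_def by blast
  then have fin: "finite (rcosets N)"
    using p_pos by (metis card.infinite power_not_zero not_gr_zero)
  obtain R :: "'a set monoid" and h where R: "R = G Mod N" and h: "h = (\<lambda>a. N #> a)" by blast
  have "group_hom G R h"
    unfolding R h by (intro group_hom.intro group_hom_axioms.intro N.factorgroup_is_group N.r_coset_hom_Mod is_group)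
  interpret h: group_hom G R h by fact
  have h1: "h x = \<one>\<^bsub>R\<^esub> \<longleftrightarrow> x \<in> N" if "x \<in> carrier G" for x
    using that coset_join1[of N x] coset_join2[of x N] N.subgroup_axioms N.subset
    by (auto simp: R h)
  have surj: "h ` carrier G = carrier R" by (simp add: carrier_FactGroup R h)
  have ordR: "order R = p ^ m" using m by (simp add: order_def R FactGroup_def)
  show ?case
  proof (cases "m = 0")
    case True
    then have "card (carrier R) = 1" using ordR by (simp add: order_def)
    then have "carrier R = {\<one>\<^bsub>R\<^esub>}" by (metis card_1_singletonE h.H.one_closed singletonD)
    then have "carrier G \<subseteq> N" using h1 h.hom_closed by blast
    then have "P 0 \<subseteq> N" by simp
    then show ?thesis ..
  next
    case False
    obtain z where z: "z \<in> carrier R" "z \<noteq> \<one>\<^bsub>R\<^esub>" "z [^]\<^bsub>R\<^esub> p = \<one>\<^bsub>R\<^esub>"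
      "\<And>g. g \<in> carrier R \<Longrightarrow> z \<otimes>\<^bsub>R\<^esub> g = g \<otimes>\<^bsub>R\<^esub> z"
      using h.H.prime_power_order_center[OF prime_p ordR] False by blast
    define M where "M = {x \<in> carrier G. x [^] p \<in> N \<and> (\<forall>u\<in>carrier G. commutator G x u \<in> N)}"
    have M_iff: "x \<in> M \<longleftrightarrow> x \<in> carrier G \<and> h x [^]\<^bsub>R\<^esub> p = \<one>\<^bsub>R\<^esub> \<and>
        (\<forall>g\<in>carrier R. h x \<otimes>\<^bsub>R\<^esub> g = g \<otimes>\<^bsub>R\<^esub> h x)" for x
    proof -
      have "commutator G x u \<in> N \<longleftrightarrow> h x \<otimes>\<^bsub>R\<^esub> h u = h u \<otimes>\<^bsub>R\<^esub> h x"
        if "x \<in> carrier G" "u \<in> carrier G" for u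
        using h1[of "commutator G x u"] that h.H.commutator_eq_one_iff[of "h x" "h u"]
        by (simp add: h.hom_commutator)
      moreover have "x [^] p \<in> N \<longleftrightarrow> h x [^]\<^bsub>R\<^esub> p = \<one>\<^bsub>R\<^esub>" if "x \<in> carrier G"
        using h1[of "x [^] p"] that by (simp add: h.hom_nat_pow)
      ultimately show ?thesis unfolding M_def surj[symmetric] by auto
    qed
    have M: "M \<lhd> G"
      unfolding normal_inv_iff
    proof (intro conjI ballI)
      show "subgroup M G"
      proof
        fix x y assume xy: "x \<in> M" "y \<in> M"
        note xyM = xy[unfolded M_iff]
        have "(h x \<otimes>\<^bsub>R\<^esub> h y) [^]\<^bsub>R\<^esub> p = h x [^]\<^bsub>R\<^esub> p \<otimes>\<^bsub>R\<^esub> h y [^]\<^bsub>R\<^esub> p"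
        proof (rule h.H.pow_mult_distrib)
          have "h y \<in> carrier R" by (rule h.hom_closed[OF conjunct1[OF xyM(2)]])
          then show "h x \<otimes>\<^bsub>R\<^esub> h y = h y \<otimes>\<^bsub>R\<^esub> h x"
            by (rule bspec[OF conjunct2[OF conjunct2[OF xyM(1)]]])
        qed (simp_all add: conjunct1[OF xyM(1)] conjunct1[OF xyM(2)])
        then have "(h x \<otimes>\<^bsub>R\<^esub> h y) [^]\<^bsub>R\<^esub> p = \<one>\<^bsub>R\<^esub>"
          by (simp add: conjunct1[OF conjunct2[OF xyM(1)]] conjunct1[OF conjunct2[OF xyM(2)]])
        moreover have "h x \<otimes>\<^bsub>R\<^esub> h y \<otimes>\<^bsub>R\<^esub> g = g \<otimes>\<^bsub>R\<^esub> (h x \<otimes>\<^bsub>R\<^esub> h y)" if "g \<in> carrier R" for g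
          using xyM that by (intro h.H.commutes_mult) auto
        ultimately show "x \<otimes> y \<in> M"
          using conjunct1[OF xyM(1)] conjunct1[OF xyM(2)] unfolding M_iff by simp
      next
        fix x assume x: "x \<in> M"
        then have "x \<in> carrier G" "h x [^]\<^bsub>R\<^esub> p = \<one>\<^bsub>R\<^esub>" unfolding M_iff by blast+
        then have "(inv\<^bsub>R\<^esub> h x) [^]\<^bsub>R\<^esub> p = \<one>\<^bsub>R\<^esub>"
          by (simp add: h.H.nat_pow_inv)
        moreover have "inv\<^bsub>R\<^esub> h x \<otimes>\<^bsub>R\<^esub> g = g \<otimes>\<^bsub>R\<^esub> inv\<^bsub>R\<^esub> h x" if "g \<in> carrier R" for g
          using x[unfolded M_iff] that by (intro h.H.commutes_inv) auto
        ultimately show "inv x \<in> M" using conjunct1[OF x[unfolded M_iff]] unfolding M_iff by simp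
      qed (auto simp: M_iff)
      fix g x assume g: "g \<in> carrier G" and x: "x \<in> M"
      have xc: "x \<in> carrier G" and "h g \<otimes>\<^bsub>R\<^esub> h x = h x \<otimes>\<^bsub>R\<^esub> h g"
        using h.hom_closed[OF g] x unfolding M_iff by auto
      then have "h (g \<otimes> x \<otimes> inv g) = h x"
        using g by (simp add: h.H.m_assoc)
      then show "g \<otimes> x \<otimes> inv g \<in> M" using x g xc unfolding M_iff by simp
    qed
    have NM: "N \<subseteq> M"
    proof
      fix x assume "x \<in> N"
      then have "x \<in> carrier G" "h x = \<one>\<^bsub>R\<^esub>" using h1 N.mem_carrier by blast+
      then show "x \<in> M" unfolding M_iff by simp
    qed
    have Mo: "openin T M"
      by (rule openin_subgroupI[OF normal_imp_subgroup[OF M] less.prems(2) N.one_closed NM])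
    interpret M: normal M G by (rule M)
    obtain x where x: "x \<in> carrier G" "h x = z"
      using z(1) by (auto simp flip: surj)
    have "x \<in> M" unfolding M_iff x(2) using x(1) z(3,4) by blast
    moreover have "x \<notin> N" using h1[OF x(1)] x(2) z(2) by simp
    ultimately have xM: "x \<in> M" "x \<notin> N" by blast+
    have coset: "M <#> (N #> g) = M #> g" if g: "g \<in> carrier G" for g
    proof -
      have "M <#> (N #> g) = (M <#> N) #> g"
        using g M.subset N.subset by (simp add: setmult_rcos_assoc)
      also have "M <#> N = M"
      proof
        show "M <#> N \<subseteq> M" using NM by (auto simp: set_mult_def)
        show "M \<subseteq> M <#> N"
        proof
          fix y assume "y \<in> M"
          then have "y = y \<otimes> \<one>" by simp
          with \<open>y \<in> M\<close> show "y \<in> M <#> N" unfolding set_mult_def using N.one_closed by blast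
        qed
      qed
      finally show ?thesis .
    qed
    have img: "rcosets M = (\<lambda>C. M <#> C) ` (rcosets N)"
      by (auto simp: RCOSETS_def coset image_iff)
    \<comment> \<open>The index drops: the cosets of \<open>N\<close> are mapped onto those of \<open>M\<close>, and \<open>N\<close> and \<open>N x\<close>
      with \<open>x \<in> M - N\<close> have the same image.\<close>
    have "\<not> inj_on (\<lambda>C. M <#> C) (rcosets N)"
    proof
      assume "inj_on (\<lambda>C. M <#> C) (rcosets N)"
      moreover have "M <#> (N #> x) = M <#> (N #> \<one>)"
        using x xM coset_join2[of x M] coset_join2[of \<one> M] M.subgroup_axioms
        by (simp add: coset)
      moreover have "N #> x \<in> rcosets N" "N #> \<one> \<in> rcosets N"
        using x N.subset by (blast intro: rcosetsI)+
      ultimately have "N #> x = N #> \<one>" by (meson inj_onD)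
      then have "h x = \<one>\<^bsub>R\<^esub>" using N.subset by (simp add: h R)
      then show False using h1 x xM by blast
    qed
    then have "card (rcosets M) < card (rcosets N)"
      using fin card_image_le[OF fin, of "\<lambda>C. M <#> C"] eq_card_imp_inj_on[OF fin, of "\<lambda>C. M <#> C"]
      by (auto simp: img le_less)
    from less.hyps[OF this M Mo] obtain k where k: "P k \<subseteq> M" by blast
    have "P (Suc k) \<subseteq> N"
    proof (rule lower_p_series_Suc_subsetI[OF N.subgroup_axioms])
      show "closedin T N" by (rule closedin_open_subgroup[OF N.subgroup_axioms less.prems(2)])
      fix x assume "x \<in> P k"
      then have "x \<in> M" by (rule subsetD[OF k])
      then show "x [^] p \<in> N" and "\<And>u. u \<in> carrier G \<Longrightarrow> commutator G x u \<in> N"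
        unfolding M_def by blast+
    qed
    then show ?thesis ..
  qed
qed

lemma open_contains_lower_p_series:
  assumes "openin T W" "\<one> \<in> W"
  shows "\<exists>k. P k \<subseteq> W"
  using normal_core_open[OF assms] normal_open_contains_lower_p_series by (metis order_trans)

end

section \<open>Powerful pro-p groups: sections consist of p-th powers\<close>

locale powerful_pro_p = pro_p +
  assumes powerful: "powerful_pro_p_group p G T"
begin

text \<open>
  The commutator condition in the definition of a powerful group, without the quotient group.
\<close>

lemma commutator_in_closed_span_powers:
  assumes comm: "comm_group (G Mod (T closure_of power_subgroup G n))"
    and x: "x \<in> carrier G" and u: "u \<in> carrier G"
  shows "commutator G x u \<in> closed_span {x [^] n | x. x \<in> carrier G}"
proof -
  define L where "L = closed_span {x [^] n | x. x \<in> carrier G}"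
  have L: "L = T closure_of power_subgroup G n"
    by (simp add: L_def closed_span_def power_subgroup_def)
  have "power_subgroup G n \<lhd> G"
    unfolding power_subgroup_def
  proof (rule normal_generateI)
    fix y g assume "y \<in> {x [^] n | x. x \<in> carrier G}" and g: "g \<in> carrier G"
    then obtain x where x: "x \<in> carrier G" "y = x [^] n" by blast
    then have "g \<otimes> y \<otimes> inv g = (g \<otimes> x \<otimes> inv g) [^] n"
      using conjugate_pow[of x "inv g" n] g by simp
    then show "g \<otimes> y \<otimes> inv g \<in> {x [^] n | x. x \<in> carrier G}" using g x by auto
  qed auto
  then interpret L: normal L G unfolding L by (rule normal_closure)
  interpret Q: comm_group "G Mod L" using comm L by simp
  interpret h: group_hom G "G Mod L" "\<lambda>a. L #> a"
    by (intro group_hom.intro group_hom_axioms.intro L.factorgroup_is_group L.r_coset_hom_Mod is_group)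
  have "(L #> x) \<otimes>\<^bsub>G Mod L\<^esub> (L #> u) = (L #> u) \<otimes>\<^bsub>G Mod L\<^esub> (L #> x)"
    using x u h.hom_closed by (intro Q.m_comm) auto
  then have "L #> commutator G x u = \<one>\<^bsub>G Mod L\<^esub>"
    unfolding h.hom_commutator[OF x u]
    by (subst Q.commutator_eq_one_iff) (use x u h.hom_closed in auto)
  then have "L #> commutator G x u = L" by simp
  then show ?thesis
    using coset_join1[of L "commutator G x u"] x u L.subgroup_axioms L.subset by (simp add: L_def)
qed

text \<open>
  For \<open>p = 2\<close> the condition on fourth powers makes commutators one step deeper than the series
  demands. The induction step looks at \<open>y\<^sup>2\<close> and \<open>[y, v]\<close> for \<open>y \<in> P k\<close>, which generate
  \<open>P (k + 1)\<close>: by induction \<open>w = [y, u]\<close> lies in \<open>P (k + 2)\<close> and is central of exponent 2 modulo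
  \<open>P (k + 3)\<close>, so \<open>y\<^sup>2\<close> and its conjugate \<open>(y w)\<^sup>2\<close> agree there.
\<close>

lemma commutator_two_steps:
  assumes p2: "p = 2"
  shows "x \<in> P k \<Longrightarrow> u \<in> carrier G \<Longrightarrow> commutator G x u \<in> P (Suc (Suc k))"
proof (induction k arbitrary: x u)
  case 0
  have "comm_group (G Mod (T closure_of power_subgroup G 4))"
    using powerful p2 by (simp add: powerful_pro_p_group_def)
  then have "commutator G x u \<in> closed_span {x [^] (4::nat) | x. x \<in> carrier G}"
    using 0 by (intro commutator_in_closed_span_powers) auto
  also have "\<dots> \<subseteq> P (Suc (Suc 0))"
  proof (rule closed_span_minimal[OF subgroup_lower_p_series closedin_lower_p_series])
    have "x [^] (4::nat) \<in> P (Suc (Suc 0))" if "x \<in> carrier G" for x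
    proof -
      have "p ^ Suc (Suc 0) = 4" using p2 by simp
      then show ?thesis using pow_prime_power_in_lower_p_series[OF that, of "Suc (Suc 0)"] by simp
    qed
    then show "{x [^] (4::nat) | x. x \<in> carrier G} \<subseteq> P (Suc (Suc 0))" by blast
  qed
  finally show ?case .
next
  case (Suc k)
  let ?Z = "{x \<in> carrier G. \<forall>u\<in>carrier G. commutator G x u \<in> P (Suc (Suc (Suc k)))}"
  obtain R :: "'a set monoid" and h where hom: "group_hom G R h"
    and h1: "\<And>x. x \<in> carrier G \<Longrightarrow> h x = \<one>\<^bsub>R\<^esub> \<longleftrightarrow> x \<in> P (Suc (Suc (Suc k)))"
    and surj: "h ` carrier G = carrier R"
    and hp: "\<And>x. x \<in> P (Suc (Suc k)) \<Longrightarrow> h x [^]\<^bsub>R\<^esub> p = \<one>\<^bsub>R\<^esub>"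
    and hc: "\<And>x g. x \<in> P (Suc (Suc k)) \<Longrightarrow> g \<in> carrier R \<Longrightarrow> h x \<otimes>\<^bsub>R\<^esub> g = g \<otimes>\<^bsub>R\<^esub> h x"
    using obtain_lower_p_series_quotient[of "Suc (Suc k)"] by blast
  interpret h: group_hom G R h by fact
  have "P (Suc k) \<subseteq> ?Z"
  proof (rule lower_p_series_Suc_subsetI)
    show "subgroup ?Z G"
      by (rule normal.subgroup_central_modulo[OF normal_lower_p_series])
    show "closedin T ?Z"
      by (rule closedin_central_modulo[OF closedin_lower_p_series])
    fix y assume y: "y \<in> P k"
    note yc = lower_p_series_carrier[OF y]
    have "commutator G (y [^] p) u \<in> P (Suc (Suc (Suc k)))" if u: "u \<in> carrier G" for u
    proof -
      define w where "w = commutator G y u"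
      have w: "w \<in> P (Suc (Suc k))" unfolding w_def using Suc.IH y u by blast
      note wc = lower_p_series_carrier[OF w]
      have "y [^] p \<otimes> commutator G (y [^] p) u = inv u \<otimes> y [^] p \<otimes> u"
        using mult_commutator(2) yc u by simp
      also have "\<dots> = (inv u \<otimes> y \<otimes> u) [^] p" using yc u by (simp add: conjugate_pow)
      also have "\<dots> = (y \<otimes> w) [^] p" using mult_commutator(2)[OF yc u] by (simp add: w_def)
      finally have "h (y [^] p \<otimes> commutator G (y [^] p) u) = h ((y \<otimes> w) [^] p)" by simp
      moreover have "h ((y \<otimes> w) [^] p) = h y [^]\<^bsub>R\<^esub> p \<otimes>\<^bsub>R\<^esub> h w [^]\<^bsub>R\<^esub> p"
      proof -
        have "h y \<otimes>\<^bsub>R\<^esub> h w = h w \<otimes>\<^bsub>R\<^esub> h y" using hc[OF w h.hom_closed[OF yc]] by (rule sym)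
        then have "(h y \<otimes>\<^bsub>R\<^esub> h w) [^]\<^bsub>R\<^esub> p = h y [^]\<^bsub>R\<^esub> p \<otimes>\<^bsub>R\<^esub> h w [^]\<^bsub>R\<^esub> p"
          using yc wc by (intro h.H.pow_mult_distrib) simp_all
        then show ?thesis using yc wc by (simp add: h.hom_nat_pow)
      qed
      ultimately have "h y [^]\<^bsub>R\<^esub> p \<otimes>\<^bsub>R\<^esub> h (commutator G (y [^] p) u) = h y [^]\<^bsub>R\<^esub> p"
        using hp[OF w] yc wc u by (simp add: h.hom_nat_pow)
      then have "h y [^]\<^bsub>R\<^esub> p \<otimes>\<^bsub>R\<^esub> h (commutator G (y [^] p) u) = h y [^]\<^bsub>R\<^esub> p \<otimes>\<^bsub>R\<^esub> \<one>\<^bsub>R\<^esub>"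
        using yc by simp
      then have "h (commutator G (y [^] p) u) = \<one>\<^bsub>R\<^esub>"
        by (rule h.H.mult_left_cancel) (use yc u in simp_all)
      then show ?thesis using h1 yc u by simp
    qed
    then show "y [^] p \<in> ?Z" using yc by simp
    fix v assume v: "v \<in> carrier G"
    have "commutator G y v \<in> P (Suc (Suc k))" using Suc.IH y v by blast
    then show "commutator G y v \<in> ?Z"
      using commutator_in_lower_p_series lower_p_series_carrier by blast
  qed
  then show ?case using Suc.prems by blast
qed

text \<open>
  The correction term of the \<open>p\<close>-th power of a product vanishes two steps down: for odd \<open>p\<close> because
  \<open>p\<close> divides the binomial coefficient, for \<open>p = 2\<close> by the preceding lemma.
\<close>

lemma commutator_binomial_pow:
  assumes x: "x \<in> P k" and u: "u \<in> carrier G"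
  shows "commutator G x u [^] (p choose 2) \<in> P (Suc (Suc k))"
proof (cases "p = 2")
  case True
  then show ?thesis using commutator_two_steps[OF True x u] lower_p_series_carrier[OF x] u by simp
next
  case False
  then have "odd p" using prime_p primes_dvd_imp_eq two_is_prime_nat by blast
  then obtain m where m: "p - 1 = 2 * m" by (metis even_diff_nat odd_one oddE diff_add_inverse2)
  then have b: "p choose 2 = p * m" by (simp add: choose_two)
  note xc = lower_p_series_carrier[OF x]
  have "commutator G x u [^] p \<in> P (Suc (Suc k))"
    using x u by (intro pow_in_lower_p_series commutator_in_lower_p_series)
  then have "(commutator G x u [^] p) [^] m \<in> P (Suc (Suc k))"
    by (rule subgroup_nat_pow[OF subgroup_lower_p_series])
  then show ?thesis using xc u by (simp add: b nat_pow_pow)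
qed

text \<open>
  Multiplicativity of the \<open>p\<close>-th power modulo \<open>P (k + 2)\<close>, where \<open>h\<close> is the quotient map. It suffices
  that one of the two factors lies in \<open>P k\<close>, because then the commutator lies in \<open>P (k + 1)\<close>, which is
  central modulo \<open>P (k + 2)\<close>.
\<close>

lemma pow_mult_modulo:
  assumes hom: "group_hom G R h"
    and h1: "\<And>x. x \<in> carrier G \<Longrightarrow> h x = \<one>\<^bsub>R\<^esub> \<longleftrightarrow> x \<in> P (Suc (Suc k))"
    and surj: "h ` carrier G = carrier R"
    and y: "y \<in> carrier G" and w: "w \<in> P k"
  shows "(h y \<otimes>\<^bsub>R\<^esub> h w) [^]\<^bsub>R\<^esub> p = h y [^]\<^bsub>R\<^esub> p \<otimes>\<^bsub>R\<^esub> h w [^]\<^bsub>R\<^esub> p"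
proof -
  interpret h: group_hom G R h by fact
  note wc = lower_p_series_carrier[OF w]
  have cw: "commutator G w y \<in> P (Suc k)" using commutator_in_lower_p_series w y by blast
  show ?thesis
  proof (rule h.H.mult_pow_eq)
    show "h y \<in> carrier R" "h w \<in> carrier R" using y wc by auto
    have eq: "commutator R (h w) (h y) = h (commutator G w y)"
      using y wc by (simp add: h.hom_commutator)
    show "commutator R (h w) (h y) [^]\<^bsub>R\<^esub> (p choose 2) = \<one>\<^bsub>R\<^esub>"
      unfolding eq using commutator_binomial_pow[OF w y] h1[of "commutator G w y [^] (p choose 2)"] y wc
      by (simp add: h.hom_nat_pow)
    fix g assume "g \<in> carrier R"
    then obtain v where v: "v \<in> carrier G" "g = h v" using surj by blast
    have "commutator R (h (commutator G w y)) (h v) = \<one>\<^bsub>R\<^esub>"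
      using commutator_in_lower_p_series[OF cw v(1)] h1[of "commutator G (commutator G w y) v"] v y wc
      by (simp add: h.hom_commutator)
    then show "commutator R (h w) (h y) \<otimes>\<^bsub>R\<^esub> g = g \<otimes>\<^bsub>R\<^esub> commutator R (h w) (h y)"
      unfolding eq v(2) using h.H.commutator_eq_one_iff v y wc by simp
  qed
qed

text \<open>
  The elements that are congruent modulo \<open>P (k + 2)\<close> to the \<open>p\<close>-th power of an element of \<open>P k\<close>. Written
  as a product of two compact sets it is visibly closed.
\<close>

definition powers_modulo :: "nat \<Rightarrow> 'a set" where
  "powers_modulo k = (\<lambda>(y, z). y \<otimes> z) ` ((\<lambda>y. y [^] p) ` P k \<times> P (Suc (Suc k)))"

lemma closedin_powers_modulo: "closedin T (powers_modulo k)"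
proof -
  have "continuous_map T T (\<lambda>y. y [^] p)" using continuous_map_nat_pow[OF continuous_map_id[of T]] by (simp add: id_def)
  then have "compactin T ((\<lambda>y. y [^] p) ` P k)"
    by (rule image_compactin[OF closedin_imp_compactin[OF closedin_lower_p_series]])
  from compactin_times_image[OF this closedin_imp_compactin[OF closedin_lower_p_series]]
  show ?thesis unfolding powers_modulo_def by (rule compactin_imp_closedin[OF Hausdorff])
qed

lemma powers_modulo_iff:
  assumes hom: "group_hom G R h"
    and h1: "\<And>x. x \<in> carrier G \<Longrightarrow> h x = \<one>\<^bsub>R\<^esub> \<longleftrightarrow> x \<in> P (Suc (Suc k))"
  shows "x \<in> powers_modulo k \<longleftrightarrow> x \<in> carrier G \<and> (\<exists>y\<in>P k. h x = h y [^]\<^bsub>R\<^esub> p)"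
proof
  interpret h: group_hom G R h by fact
  show "x \<in> carrier G \<and> (\<exists>y\<in>P k. h x = h y [^]\<^bsub>R\<^esub> p)" if "x \<in> powers_modulo k"
  proof -
    from that obtain y z where x: "x = y [^] p \<otimes> z" and y: "y \<in> P k" and z: "z \<in> P (Suc (Suc k))"
      by (auto simp: powers_modulo_def)
    note c = lower_p_series_carrier[OF y] lower_p_series_carrier[OF z]
    then have "h x = h y [^]\<^bsub>R\<^esub> p" using h1[of z] z by (simp add: x h.hom_nat_pow)
    then show ?thesis using c x y by auto
  qed
  assume "x \<in> carrier G \<and> (\<exists>y\<in>P k. h x = h y [^]\<^bsub>R\<^esub> p)"
  then obtain y where x: "x \<in> carrier G" and y: "y \<in> P k" "h x = h y [^]\<^bsub>R\<^esub> p" by blast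
  note yc = lower_p_series_carrier[OF y(1)]
  have "h (inv (y [^] p) \<otimes> x) = \<one>\<^bsub>R\<^esub>" using x y yc by (simp add: h.hom_nat_pow)
  then have "inv (y [^] p) \<otimes> x \<in> P (Suc (Suc k))" using h1[of "inv (y [^] p) \<otimes> x"] x yc by blast
  moreover have "x = y [^] p \<otimes> (inv (y [^] p) \<otimes> x)" using x yc by (simp flip: m_assoc)
  ultimately show "x \<in> powers_modulo k" using y(1) unfolding powers_modulo_def by force
qed

lemma subgroup_powers_modulo: "subgroup (powers_modulo k) G"
proof -
  obtain R :: "'a set monoid" and h where hom: "group_hom G R h"
    and h1: "\<And>x. x \<in> carrier G \<Longrightarrow> h x = \<one>\<^bsub>R\<^esub> \<longleftrightarrow> x \<in> P (Suc (Suc k))"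
    and surj: "h ` carrier G = carrier R"
    using obtain_lower_p_series_quotient[of "Suc k"] by metis
  interpret h: group_hom G R h by fact
  have iff: "x \<in> powers_modulo k \<longleftrightarrow> x \<in> carrier G \<and> (\<exists>y\<in>P k. h x = h y [^]\<^bsub>R\<^esub> p)" for x
    by (rule powers_modulo_iff[OF hom]) (rule h1)
  note sub = subgroup_lower_p_series[of k]
  show ?thesis
  proof
    fix x y assume "x \<in> powers_modulo k" "y \<in> powers_modulo k"
    then obtain a b where xc: "x \<in> carrier G" "y \<in> carrier G" and a: "a \<in> P k" "h x = h a [^]\<^bsub>R\<^esub> p"
      and b: "b \<in> P k" "h y = h b [^]\<^bsub>R\<^esub> p" unfolding iff by blast
    note c = lower_p_series_carrier[OF a(1)] lower_p_series_carrier[OF b(1)]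
    have "h (x \<otimes> y) = h (a \<otimes> b) [^]\<^bsub>R\<^esub> p"
      using pow_mult_modulo[OF hom h1 surj c(1) b(1)] a b c xc by simp
    moreover have "a \<otimes> b \<in> P k" using subgroup.m_closed[OF sub] a b by blast
    ultimately show "x \<otimes> y \<in> powers_modulo k" unfolding iff using xc by blast
  next
    have "h \<one> = h \<one> [^]\<^bsub>R\<^esub> p" by simp
    then show "\<one> \<in> powers_modulo k" unfolding iff using subgroup.one_closed[OF sub] by blast
  next
    fix x assume "x \<in> powers_modulo k"
    then obtain a where xc: "x \<in> carrier G" and a: "a \<in> P k" "h x = h a [^]\<^bsub>R\<^esub> p" unfolding iff by blast
    have "h (inv x) = h (inv a) [^]\<^bsub>R\<^esub> p"
      using lower_p_series_carrier[OF a(1)] a xc by (simp add: h.H.nat_pow_inv)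
    then show "inv x \<in> powers_modulo k" unfolding iff
      using xc subgroup.m_inv_closed[OF sub a(1)] by blast
  qed (auto simp: iff)
qed

lemma pow_in_powers_modulo:
  assumes "y \<in> P k" shows "y [^] p \<in> powers_modulo k"
proof -
  have "y [^] p = y [^] p \<otimes> \<one>" using lower_p_series_carrier[OF assms] by simp
  then show ?thesis using assms subgroup.one_closed[OF subgroup_lower_p_series]
    unfolding powers_modulo_def by force
qed

text \<open>
  The heart of the theory of powerful groups: \<open>P (k + 1)\<close> consists of \<open>p\<close>-th powers modulo \<open>P (k + 2)\<close>.
  As \<open>powers_modulo k\<close> is a closed subgroup, only the commutators \<open>[x, u]\<close> with \<open>x \<in> P k\<close> need
  attention. For \<open>k = 0\<close> this is the hypothesis that the group is powerful. For the step, write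
  \<open>x = y ^ p z\<close> by induction; then \<open>[x, u]\<close> is congruent to \<open>w ^ p\<close> with \<open>w = [y, u]\<close>, since
  conjugation by \<open>u\<close> turns \<open>y ^ p\<close> into \<open>(y w) ^ p\<close> and fixes \<open>z\<close> modulo \<open>P (k + 3)\<close>.
\<close>

lemma lower_p_series_Suc_subset_powers: "P (Suc k) \<subseteq> powers_modulo k"
proof -
  have step: "P (Suc k) \<subseteq> powers_modulo k"
    if "\<forall>x\<in>P k. \<forall>u\<in>carrier G. commutator G x u \<in> powers_modulo k" for k
    by (rule lower_p_series_Suc_subsetI[OF subgroup_powers_modulo closedin_powers_modulo])
      (use that in \<open>auto intro: pow_in_powers_modulo\<close>)
  have comm: "\<forall>x\<in>P k. \<forall>u\<in>carrier G. commutator G x u \<in> powers_modulo k" for k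
  proof (induction k)
    case 0
    show ?case
    proof (intro ballI)
      fix x u assume xu: "x \<in> P 0" "u \<in> carrier G"
      \<comment> \<open>Both exponents in the definition, \<open>p\<close> and \<open>4 = 2 * 2\<close>, are powers of \<open>p\<close>, so the
        two cases can be continued together.\<close>
      obtain n where n: "n = p \<or> n = p * p" and "comm_group (G Mod (T closure_of power_subgroup G n))"
      proof (cases "p = 2")
        case True
        then have "comm_group (G Mod (T closure_of power_subgroup G (p * p)))"
          using powerful by (simp add: powerful_pro_p_group_def)
        then show ?thesis using that by blast
      next
        case False
        then have "comm_group (G Mod (T closure_of power_subgroup G p))"
          using powerful by (simp add: powerful_pro_p_group_def)
        then show ?thesis using that by blast
      qed
      then have "commutator G x u \<in> closed_span {x [^] n | x. x \<in> carrier G}"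
        using commutator_in_closed_span_powers xu by simp
      also have "\<dots> \<subseteq> powers_modulo 0"
      proof (rule closed_span_minimal[OF subgroup_powers_modulo closedin_powers_modulo])
        have "x [^] n \<in> powers_modulo 0" if "x \<in> carrier G" for x
          using n pow_in_powers_modulo[of x 0] pow_in_powers_modulo[of "x [^] p" 0] that
          by (auto simp: nat_pow_pow)
        then show "{x [^] n | x. x \<in> carrier G} \<subseteq> powers_modulo 0" by blast
      qed
      finally show "commutator G x u \<in> powers_modulo 0" .
    qed
  next
    case (Suc k)
    obtain R :: "'a set monoid" and h where hom: "group_hom G R h"
      and h1: "\<And>x. x \<in> carrier G \<Longrightarrow> h x = \<one>\<^bsub>R\<^esub> \<longleftrightarrow> x \<in> P (Suc (Suc (Suc k)))"
      and surj: "h ` carrier G = carrier R"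
      and hp: "\<And>x. x \<in> P (Suc (Suc k)) \<Longrightarrow> h x [^]\<^bsub>R\<^esub> p = \<one>\<^bsub>R\<^esub>"
      and hc: "\<And>x g. x \<in> P (Suc (Suc k)) \<Longrightarrow> g \<in> carrier R \<Longrightarrow> h x \<otimes>\<^bsub>R\<^esub> g = g \<otimes>\<^bsub>R\<^esub> h x"
      using obtain_lower_p_series_quotient[of "Suc (Suc k)"] by blast
    interpret h: group_hom G R h by fact
    have iff: "x \<in> powers_modulo (Suc k) \<longleftrightarrow>
        x \<in> carrier G \<and> (\<exists>y\<in>P (Suc k). h x = h y [^]\<^bsub>R\<^esub> p)" for x
      by (rule powers_modulo_iff[OF hom]) (rule h1)
    show ?case
    proof (intro ballI)
      fix x u assume x: "x \<in> P (Suc k)" and u: "u \<in> carrier G"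
      have "x \<in> powers_modulo k" using step[OF Suc] x by blast
      then obtain y z where xyz: "x = y [^] p \<otimes> z" and y: "y \<in> P k" and z: "z \<in> P (Suc (Suc k))"
        by (auto simp: powers_modulo_def)
      note yc = lower_p_series_carrier[OF y] and zc = lower_p_series_carrier[OF z]
        and xc = lower_p_series_carrier[OF x]
      define w where "w = commutator G y u"
      have w: "w \<in> P (Suc k)" unfolding w_def using commutator_in_lower_p_series y u by blast
      note wc = lower_p_series_carrier[OF w]
      have hz: "inv\<^bsub>R\<^esub> h u \<otimes>\<^bsub>R\<^esub> h z \<otimes>\<^bsub>R\<^esub> h u = h z"
      proof -
        have "h z \<otimes>\<^bsub>R\<^esub> h u = h u \<otimes>\<^bsub>R\<^esub> h z" by (rule hc[OF z h.hom_closed[OF u]])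
        then have "inv\<^bsub>R\<^esub> h u \<otimes>\<^bsub>R\<^esub> (h z \<otimes>\<^bsub>R\<^esub> h u) = inv\<^bsub>R\<^esub> h u \<otimes>\<^bsub>R\<^esub> (h u \<otimes>\<^bsub>R\<^esub> h z)"
          by (rule arg_cong)
        then show ?thesis using u zc by (simp flip: h.H.m_assoc)
      qed
      have hy: "inv\<^bsub>R\<^esub> h u \<otimes>\<^bsub>R\<^esub> h y \<otimes>\<^bsub>R\<^esub> h u = h y \<otimes>\<^bsub>R\<^esub> h w"
        using arg_cong[OF mult_commutator(2)[OF yc u], of h] yc u wc by (simp add: w_def)
      have pw: "(h y \<otimes>\<^bsub>R\<^esub> h w) [^]\<^bsub>R\<^esub> p = h y [^]\<^bsub>R\<^esub> p \<otimes>\<^bsub>R\<^esub> h w [^]\<^bsub>R\<^esub> p"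
        by (rule pow_mult_modulo[OF hom h1 surj yc w])
      have "h x \<otimes>\<^bsub>R\<^esub> h (commutator G x u) = inv\<^bsub>R\<^esub> h u \<otimes>\<^bsub>R\<^esub> (h y [^]\<^bsub>R\<^esub> p \<otimes>\<^bsub>R\<^esub> h z) \<otimes>\<^bsub>R\<^esub> h u"
        using arg_cong[OF mult_commutator(2)[OF xc u], of h] xc yc zc u
        by (simp add: xyz h.hom_nat_pow)
      also have "\<dots> = (inv\<^bsub>R\<^esub> h u \<otimes>\<^bsub>R\<^esub> h y [^]\<^bsub>R\<^esub> p \<otimes>\<^bsub>R\<^esub> h u) \<otimes>\<^bsub>R\<^esub> (inv\<^bsub>R\<^esub> h u \<otimes>\<^bsub>R\<^esub> h z \<otimes>\<^bsub>R\<^esub> h u)"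
      proof -
        have "h u \<otimes>\<^bsub>R\<^esub> (inv\<^bsub>R\<^esub> h u \<otimes>\<^bsub>R\<^esub> g) = g" if "g \<in> carrier R" for g
          using that u by (simp flip: h.H.m_assoc)
        then show ?thesis using yc zc u by (simp add: h.H.m_assoc)
      qed
      also have "\<dots> = h y [^]\<^bsub>R\<^esub> p \<otimes>\<^bsub>R\<^esub> h w [^]\<^bsub>R\<^esub> p \<otimes>\<^bsub>R\<^esub> h z"
        using h.H.conjugate_pow[OF h.hom_closed[OF yc] h.hom_closed[OF u], of p] by (simp only: hz hy pw)
      also have "\<dots> = h x \<otimes>\<^bsub>R\<^esub> h w [^]\<^bsub>R\<^esub> p"
      proof -
        have "h w [^]\<^bsub>R\<^esub> p \<otimes>\<^bsub>R\<^esub> h z = h z \<otimes>\<^bsub>R\<^esub> h w [^]\<^bsub>R\<^esub> p"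
          by (rule sym[OF hc[OF z]]) (use wc in simp)
        then show ?thesis using yc zc wc by (simp add: xyz h.hom_nat_pow h.H.m_assoc)
      qed
      finally have "h (commutator G x u) = h w [^]\<^bsub>R\<^esub> p"
        by (rule h.H.mult_left_cancel) (use xc wc u in simp_all)
      then show "commutator G x u \<in> powers_modulo (Suc k)"
        unfolding iff using commutator_closed[OF xc u] w by (intro conjI bexI[of _ w])
    qed
  qed
  show "P (Suc k) \<subseteq> powers_modulo k" by (rule step[OF comm])
qed

end

section \<open>Decomposition into procyclic subgroups\<close>

context powerful_pro_p
begin

text \<open>
  Modulo \<open>P 1\<close> the group is abelian of exponent \<open>p\<close>, so the products of the generators form a finite
  subgroup of the quotient. Its preimage is a closed subgroup that contains the generators, and
  hence it is everything.
\<close>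

lemma generators_modulo_Frattini:
  assumes as: "set as \<subseteq> carrier G" and gen: "closed_span (set as) = carrier G"
    and x: "x \<in> carrier G"
  shows "\<exists>c\<in>power_products G UNIV 1 as. \<exists>z\<in>P 1. x = c \<otimes> z"
proof -
  obtain R :: "'a set monoid" and h where hom: "group_hom G R h"
    and h1: "\<And>x. x \<in> carrier G \<Longrightarrow> h x = \<one>\<^bsub>R\<^esub> \<longleftrightarrow> x \<in> P (Suc 0)"
    and surj: "h ` carrier G = carrier R"
    and hp: "\<And>x. x \<in> P 0 \<Longrightarrow> h x [^]\<^bsub>R\<^esub> p = \<one>\<^bsub>R\<^esub>"
    and hc: "\<And>x g. x \<in> P 0 \<Longrightarrow> g \<in> carrier R \<Longrightarrow> h x \<otimes>\<^bsub>R\<^esub> g = g \<otimes>\<^bsub>R\<^esub> h x"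
    using obtain_lower_p_series_quotient[of 0] by blast
  interpret h: group_hom G R h by fact
  define F where "F = power_products R UNIV 1 (map h as)"
  have has: "set (map h as) \<subseteq> carrier R" using as by auto
  have "F \<subseteq> power_products R {..<p} 1 (map h as)"
    unfolding F_def
  proof (rule h.H.power_products_reduce[OF has _ p_pos])
    fix b assume "b \<in> set (map h as)"
    then obtain a where "a \<in> carrier G" "b = h a" using as by auto
    then show "b [^]\<^bsub>R\<^esub> (1 * p) = \<one>\<^bsub>R\<^esub>" using hp[of a] by simp
  qed
  then have finF: "finite F" using finite_power_products[of "{..<p}"] finite_subset by blast
  have multF: "f \<otimes>\<^bsub>R\<^esub> g \<in> F" if "f \<in> F" "g \<in> F" for f g
    unfolding F_def
  proof (rule h.H.power_products_mult[OF has, where r = 1])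
    fix b g assume "b \<in> set (map h as)" and g: "g \<in> carrier R"
    then obtain a where a: "a \<in> carrier G" "b = h a" using as by auto
    then show "b [^]\<^bsub>R\<^esub> (1 * 1 :: nat) \<otimes>\<^bsub>R\<^esub> g = g \<otimes>\<^bsub>R\<^esub> b [^]\<^bsub>R\<^esub> (1 * 1 :: nat)"
      using hc[OF _ g, of a] by simp
  qed (use that in \<open>simp_all add: F_def\<close>)
  have oneF: "\<one>\<^bsub>R\<^esub> \<in> F" unfolding F_def by (rule h.H.one_in_power_products[OF _ has]) simp
  have powF: "f [^]\<^bsub>R\<^esub> n \<in> F" if "f \<in> F" for f and n :: nat
    by (induction n) (use that oneF multF in auto)
  define B where "B = {x \<in> carrier G. h x \<in> F}"
  have "subgroup B G"
  proof
    fix x assume x: "x \<in> B"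
    then have xc: "x \<in> carrier G" "h x \<in> F" by (auto simp: B_def)
    have "h x [^]\<^bsub>R\<^esub> (p - 1) \<otimes>\<^bsub>R\<^esub> h x = \<one>\<^bsub>R\<^esub>"
    proof -
      have "h x [^]\<^bsub>R\<^esub> Suc (p - 1) = \<one>\<^bsub>R\<^esub>" using hp[of x] xc p_pos by simp
      then show ?thesis by simp
    qed
    then have "inv\<^bsub>R\<^esub> h x = h x [^]\<^bsub>R\<^esub> (p - 1)"
      using xc by (intro h.H.inv_equality) auto
    then show "inv x \<in> B" using powF[of "h x"] xc by (simp add: B_def)
  qed (auto simp: B_def multF oneF)
  moreover have "closedin T B"
    unfolding B_def by (rule closedin_finite_preimage[OF hom h1 closedin_lower_p_series finF])
  moreover have "set as \<subseteq> B"
  proof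
    fix a assume a: "a \<in> set as"
    then have "h a [^]\<^bsub>R\<^esub> (1::nat) \<in> F"
      unfolding F_def by (intro h.H.pow_in_power_products[OF has]) simp
    then show "a \<in> B" using a as by (auto simp: B_def)
  qed
  ultimately have "carrier G \<subseteq> B" using closed_span_minimal[of B "set as"] gen by simp
  then have "h x \<in> F" using x by (auto simp: B_def)
  then obtain c where c: "c \<in> power_products G UNIV 1 as" "h c = h x"
    unfolding F_def h.image_power_products[OF as, symmetric] by auto
  have cc: "c \<in> carrier G" using c power_products_closed[OF as] by blast
  have "h (inv c \<otimes> x) = \<one>\<^bsub>R\<^esub>" using c cc x by simp
  then have "inv c \<otimes> x \<in> P 1" using h1[of "inv c \<otimes> x"] cc x by simp
  moreover have "x = c \<otimes> (inv c \<otimes> x)" using cc x by (simp flip: m_assoc)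
  ultimately show ?thesis using c by blast
qed

text \<open>
  The \<open>p\<close>-th power maps the section \<open>P k / P (k + 1)\<close> onto \<open>P (k + 1) / P (k + 2)\<close>, so the elements
  \<open>a ^ (p ^ k)\<close>, for \<open>a\<close> a generator, generate the \<open>k\<close>-th section.
\<close>

lemma generators_modulo_step:
  assumes as: "set as \<subseteq> carrier G" and gen: "closed_span (set as) = carrier G"
  shows "x \<in> P k \<Longrightarrow> \<exists>c\<in>power_products G UNIV (p ^ k) as. \<exists>z\<in>P (Suc k). x = c \<otimes> z"
proof (induction k arbitrary: x)
  case 0
  then show ?case using generators_modulo_Frattini[OF as gen, of x] by simp
next
  case (Suc k)
  obtain R :: "'a set monoid" and h where hom: "group_hom G R h"
    and h1: "\<And>x. x \<in> carrier G \<Longrightarrow> h x = \<one>\<^bsub>R\<^esub> \<longleftrightarrow> x \<in> P (Suc (Suc k))"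
    and surj: "h ` carrier G = carrier R"
    and hp: "\<And>x. x \<in> P (Suc k) \<Longrightarrow> h x [^]\<^bsub>R\<^esub> p = \<one>\<^bsub>R\<^esub>"
    and hc: "\<And>x g. x \<in> P (Suc k) \<Longrightarrow> g \<in> carrier R \<Longrightarrow> h x \<otimes>\<^bsub>R\<^esub> g = g \<otimes>\<^bsub>R\<^esub> h x"
    using obtain_lower_p_series_quotient[of "Suc k"] by blast
  interpret h: group_hom G R h by fact
  have has: "set (map h as) \<subseteq> carrier R" using as by auto
  have "x \<in> powers_modulo k"
    using lower_p_series_Suc_subset_powers Suc.prems by blast
  then obtain y z where xyz: "x = y [^] p \<otimes> z" and y: "y \<in> P k" and z: "z \<in> P (Suc (Suc k))"
    by (auto simp: powers_modulo_def)
  obtain c d where c: "c \<in> power_products G UNIV (p ^ k) as" and d: "d \<in> P (Suc k)" and ycd: "y = c \<otimes> d"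
    using Suc.IH[OF y] by blast
  have cc: "c \<in> carrier G" using c power_products_closed[OF as] by blast
  note yc = lower_p_series_carrier[OF y] and zc = lower_p_series_carrier[OF z]
    and dc = lower_p_series_carrier[OF d]
  have sub: "subgroup (h ` P k) R"
    by (rule h.subgroup_img_is_subgroup[OF subgroup_lower_p_series])
  have mult: "(f \<otimes>\<^bsub>R\<^esub> g) [^]\<^bsub>R\<^esub> p = f [^]\<^bsub>R\<^esub> p \<otimes>\<^bsub>R\<^esub> g [^]\<^bsub>R\<^esub> p" if fg: "f \<in> h ` P k" "g \<in> h ` P k" for f g
  proof -
    obtain a b where a: "a \<in> P k" "f = h a" and b: "b \<in> P k" "g = h b" using fg by blast
    show ?thesis unfolding a b
      by (rule pow_mult_modulo[OF hom h1 surj lower_p_series_carrier[OF a(1)] b(1)])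
  qed
  have hcp: "h c [^]\<^bsub>R\<^esub> p \<in> power_products R UNIV (p ^ k * p) (map h as)"
  proof (rule conjunct2[OF h.H.power_products_pow[OF has sub]])
    show "h c \<in> power_products R UNIV (p ^ k) (map h as)"
      unfolding h.image_power_products[OF as, symmetric] using c by blast
    show "(f \<otimes>\<^bsub>R\<^esub> g) [^]\<^bsub>R\<^esub> p = f [^]\<^bsub>R\<^esub> p \<otimes>\<^bsub>R\<^esub> g [^]\<^bsub>R\<^esub> p" if "f \<in> h ` P k" "g \<in> h ` P k" for f g
      using that by (rule mult)
    fix b assume "b \<in> set (map h as)"
    then obtain a where a: "a \<in> carrier G" "b = h a" using as by auto
    then show "b [^]\<^bsub>R\<^esub> (p ^ k) \<in> h ` P k"
      using pow_prime_power_in_lower_p_series[of a k] by (auto simp flip: h.hom_nat_pow)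
  qed
  have "h x = h y [^]\<^bsub>R\<^esub> p" using h1[OF zc] z yc zc by (simp add: xyz h.hom_nat_pow)
  also have "\<dots> = h c [^]\<^bsub>R\<^esub> p \<otimes>\<^bsub>R\<^esub> h d [^]\<^bsub>R\<^esub> p"
  proof -
    have "h c \<otimes>\<^bsub>R\<^esub> h d = h d \<otimes>\<^bsub>R\<^esub> h c" by (rule sym[OF hc[OF d h.hom_closed[OF cc]]])
    then have "(h c \<otimes>\<^bsub>R\<^esub> h d) [^]\<^bsub>R\<^esub> p = h c [^]\<^bsub>R\<^esub> p \<otimes>\<^bsub>R\<^esub> h d [^]\<^bsub>R\<^esub> p"
      by (rule h.H.pow_mult_distrib) (use cc dc in simp_all)
    then show ?thesis using cc dc by (simp add: ycd)
  qed
  also have "\<dots> = h c [^]\<^bsub>R\<^esub> p" using hp[OF d] cc by simp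
  finally have "h x \<in> power_products R UNIV (p ^ Suc k) (map h as)" using hcp by (simp add: mult.commute)
  then obtain e where e: "e \<in> power_products G UNIV (p ^ Suc k) as" "h e = h x"
    unfolding h.image_power_products[OF as, symmetric] by auto
  have ec: "e \<in> carrier G" using e power_products_closed[OF as] by blast
  note xc = lower_p_series_carrier[OF Suc.prems]
  have "h (inv e \<otimes> x) = \<one>\<^bsub>R\<^esub>" using e ec xc by simp
  then have "inv e \<otimes> x \<in> P (Suc (Suc k))" using h1[of "inv e \<otimes> x"] ec xc by blast
  moreover have "x = e \<otimes> (inv e \<otimes> x)" using ec xc by (simp flip: m_assoc)
  ultimately show ?case using e by blast
qed

text \<open>
  The sections are finite by the preceding lemma, so \<open>P (k + 1)\<close> arises from \<open>P k\<close> by removing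
  finitely many closed cosets.
\<close>

lemma openin_lower_p_series:
  assumes as: "set as \<subseteq> carrier G" and gen: "closed_span (set as) = carrier G"
  shows "openin T (P k)"
proof (induction k)
  case 0
  then show ?case using openin_carrier by simp
next
  case (Suc k)
  obtain R :: "'a set monoid" and h where hom: "group_hom G R h"
    and h1: "\<And>x. x \<in> carrier G \<Longrightarrow> h x = \<one>\<^bsub>R\<^esub> \<longleftrightarrow> x \<in> P (Suc k)"
    and surj: "h ` carrier G = carrier R"
    and hp: "\<And>x. x \<in> P k \<Longrightarrow> h x [^]\<^bsub>R\<^esub> p = \<one>\<^bsub>R\<^esub>"
    and hc: "\<And>x g. x \<in> P k \<Longrightarrow> g \<in> carrier R \<Longrightarrow> h x \<otimes>\<^bsub>R\<^esub> g = g \<otimes>\<^bsub>R\<^esub> h x"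
    using obtain_lower_p_series_quotient[of k] by blast
  interpret h: group_hom G R h by fact
  have has: "set (map h as) \<subseteq> carrier R" using as by auto
  have "h ` P k \<subseteq> power_products R UNIV (p ^ k) (map h as)"
  proof clarify
    fix x assume "x \<in> P k"
    then obtain c z where c: "c \<in> power_products G UNIV (p ^ k) as" and z: "z \<in> P (Suc k)"
      and x: "x = c \<otimes> z" using generators_modulo_step[OF as gen] by blast
    have cc: "c \<in> carrier G" using c power_products_closed[OF as] by blast
    note zc = lower_p_series_carrier[OF z]
    have "h x = h c" using h1[OF zc] z cc zc by (simp add: x)
    then show "h x \<in> power_products R UNIV (p ^ k) (map h as)"
      unfolding h.image_power_products[OF as, symmetric] using c by simp
  qed
  also have "\<dots> \<subseteq> power_products R {..<p} (p ^ k) (map h as)"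
  proof (rule h.H.power_products_reduce[OF has _ p_pos])
    fix b assume "b \<in> set (map h as)"
    then obtain a where a: "a \<in> carrier G" "b = h a" using as by auto
    then show "b [^]\<^bsub>R\<^esub> (p ^ k * p) = \<one>\<^bsub>R\<^esub>"
      using hp[OF pow_prime_power_in_lower_p_series[of a k]]
      by (simp add: h.hom_nat_pow h.H.nat_pow_pow)
  qed
  finally have fin: "finite (h ` P k - {\<one>\<^bsub>R\<^esub>})"
    using finite_power_products[of "{..<p}"] finite_subset by blast
  have "closedin T {x \<in> carrier G. h x \<in> h ` P k - {\<one>\<^bsub>R\<^esub>}}"
    by (rule closedin_finite_preimage[OF hom h1 closedin_lower_p_series fin])
  then have "openin T (P k - {x \<in> carrier G. h x \<in> h ` P k - {\<one>\<^bsub>R\<^esub>}})"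
    by (rule openin_diff[OF Suc])
  moreover have "P k - {x \<in> carrier G. h x \<in> h ` P k - {\<one>\<^bsub>R\<^esub>}} = P (Suc k)"
    using h1 lower_p_series_carrier lower_p_series_Suc_subset[of k] by blast
  ultimately show ?case by simp
qed

text \<open>
  Successive approximation. The error \<open>z \<in> P (n + k)\<close> of the \<open>k\<close>-th approximation \<open>c\<close> is a product of
  elements \<open>a ^ (p ^ (n + k) m)\<close> up to an error in \<open>P (n + k + 1)\<close>. These elements are central
  modulo \<open>P (n + k + 1)\<close>, so they can be merged into \<open>c\<close>, and the number of factors does not grow.
\<close>

lemma power_products_dense:
  assumes as: "set as \<subseteq> carrier G" and gen: "closed_span (set as) = carrier G"
    and x: "x \<in> P n"
  shows "\<exists>c\<in>power_products G UNIV (p ^ n) as. \<exists>z\<in>P (n + k). x = c \<otimes> z"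
proof (induction k)
  case 0
  have "x = \<one> \<otimes> x" using lower_p_series_carrier[OF x] by simp
  then show ?case using one_in_power_products[of UNIV as] as x by auto
next
  case (Suc k)
  then obtain c z where c: "c \<in> power_products G UNIV (p ^ n) as" and z: "z \<in> P (n + k)"
    and xcz: "x = c \<otimes> z" by blast
  obtain d y where d: "d \<in> power_products G UNIV (p ^ (n + k)) as" and y: "y \<in> P (Suc (n + k))"
    and zdy: "z = d \<otimes> y" using generators_modulo_step[OF as gen z] by blast
  obtain R :: "'a set monoid" and h where hom: "group_hom G R h"
    and h1: "\<And>x. x \<in> carrier G \<Longrightarrow> h x = \<one>\<^bsub>R\<^esub> \<longleftrightarrow> x \<in> P (Suc (n + k))"
    and surj: "h ` carrier G = carrier R"
    and hp: "\<And>x. x \<in> P (n + k) \<Longrightarrow> h x [^]\<^bsub>R\<^esub> p = \<one>\<^bsub>R\<^esub>"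
    and hc: "\<And>x g. x \<in> P (n + k) \<Longrightarrow> g \<in> carrier R \<Longrightarrow> h x \<otimes>\<^bsub>R\<^esub> g = g \<otimes>\<^bsub>R\<^esub> h x"
    using obtain_lower_p_series_quotient[of "n + k"] by blast
  interpret h: group_hom G R h by fact
  have has: "set (map h as) \<subseteq> carrier R" using as by auto
  have cc: "c \<in> carrier G" "d \<in> carrier G" using c d power_products_closed[OF as] by blast+
  note yc = lower_p_series_carrier[OF y] and xc = lower_p_series_carrier[OF x]
  have "h x = h c \<otimes>\<^bsub>R\<^esub> h d" using h1[OF yc] y yc cc by (simp add: xcz zdy)
  also have "\<dots> \<in> power_products R UNIV (p ^ n) (map h as)"
  proof (rule h.H.power_products_mult[OF has, where r = "p ^ k"])
    show "h c \<in> power_products R UNIV (p ^ n) (map h as)"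
      unfolding h.image_power_products[OF as, symmetric] using c by blast
    show "h d \<in> power_products R UNIV (p ^ n * p ^ k) (map h as)"
      unfolding h.image_power_products[OF as, symmetric] using d by (simp add: power_add)
    fix b g assume "b \<in> set (map h as)" and g: "g \<in> carrier R"
    then obtain a where a: "a \<in> carrier G" "b = h a" using as by auto
    have "h (a [^] (p ^ n * p ^ k)) \<otimes>\<^bsub>R\<^esub> g = g \<otimes>\<^bsub>R\<^esub> h (a [^] (p ^ n * p ^ k))"
      using hc[OF _ g] pow_prime_power_in_lower_p_series[OF a(1), of "n + k"] unfolding power_add by blast
    then show "b [^]\<^bsub>R\<^esub> (p ^ n * p ^ k) \<otimes>\<^bsub>R\<^esub> g = g \<otimes>\<^bsub>R\<^esub> b [^]\<^bsub>R\<^esub> (p ^ n * p ^ k)"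
      using a by (simp add: h.hom_nat_pow)
  qed
  finally obtain e where e: "e \<in> power_products G UNIV (p ^ n) as" "h e = h x"
    unfolding h.image_power_products[OF as, symmetric] by auto
  have ec: "e \<in> carrier G" using e power_products_closed[OF as] by blast
  have "h (inv e \<otimes> x) = \<one>\<^bsub>R\<^esub>" using e ec xc by simp
  then have "inv e \<otimes> x \<in> P (n + Suc k)" using h1[of "inv e \<otimes> x"] ec xc by simp
  moreover have "x = e \<otimes> (inv e \<otimes> x)" using ec xc by (simp flip: m_assoc)
  ultimately show ?case using e by blast
qed

primrec procyclic_products :: "nat \<Rightarrow> 'a list \<Rightarrow> 'a set" where
  "procyclic_products q [] = {\<one>}"
| "procyclic_products q (a # as) =
     (\<lambda>(y, z). y \<otimes> z) ` (closed_span {a [^] q} \<times> procyclic_products q as)"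

lemma compactin_procyclic_products:
  "set as \<subseteq> carrier G \<Longrightarrow> compactin T (procyclic_products q as)"
proof (induction as)
  case Nil
  then show ?case by (simp add: topspace_eq)
next
  case (Cons a as)
  have "compactin T (closed_span {a [^] q})"
    using Cons.prems by (intro closedin_imp_compactin closedin_closed_span) simp
  then show ?case unfolding procyclic_products.simps
    using Cons by (intro compactin_times_image) simp_all
qed

lemma power_products_subset_procyclic:
  "set as \<subseteq> carrier G \<Longrightarrow> power_products G UNIV q as \<subseteq> procyclic_products q as"
proof (induction as)
  case (Cons a as)
  have "a [^] (q * n) \<in> closed_span {a [^] q}" for n
  proof -
    have sub: "{a [^] q} \<subseteq> carrier G" using Cons.prems by simp
    then have "(a [^] q) [^] n \<in> closed_span {a [^] q}"
      using subgroup_nat_pow[OF subgroup_closed_span[OF sub]] subset_closed_span[OF sub] by blast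
    then show ?thesis using Cons.prems by (simp add: nat_pow_pow)
  qed
  then show ?case using Cons by auto
qed simp

lemma procyclic_products_subset:
  assumes "subgroup S G" "\<And>a. a \<in> set as \<Longrightarrow> closed_span {a [^] q} \<subseteq> S"
  shows "procyclic_products q as \<subseteq> S"
  using assms(2)
proof (induction as)
  case Nil
  then show ?case using subgroup.one_closed[OF assms(1)] by simp
next
  case (Cons a as)
  then show ?case by (auto intro!: subgroup.m_closed[OF assms(1)])
qed

text \<open>
  The product of procyclic subgroups is compact, hence closed, and by \<open>power_products_dense\<close> it meets
  every neighbourhood of every element of \<open>P n\<close>.
\<close>

theorem lower_p_series_subset_procyclic_products:
  assumes as: "set as \<subseteq> carrier G" and gen: "closed_span (set as) = carrier G"
  shows "P n \<subseteq> procyclic_products (p ^ n) as"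
proof
  fix x assume x: "x \<in> P n"
  note xc = lower_p_series_carrier[OF x]
  let ?C = "procyclic_products (p ^ n) as"
  show "x \<in> ?C"
  proof (rule ccontr)
    assume no: "x \<notin> ?C"
    have "closedin T ?C"
      by (rule compactin_imp_closedin[OF Hausdorff compactin_procyclic_products[OF as]])
    then have op: "openin T (carrier G - ?C)" using openin_carrier by (rule openin_diff[rotated])
    have "continuous_map T T (\<lambda>z. x \<otimes> inv z)"
      using xc by (auto intro!: continuous_map_times continuous_map_carrier_const continuous_inv)
    from openin_continuous_map_preimage[OF this op]
    have "openin T {z \<in> carrier G. x \<otimes> inv z \<in> carrier G - ?C}" by (simp add: topspace_eq)
    moreover have "\<one> \<in> {z \<in> carrier G. x \<otimes> inv z \<in> carrier G - ?C}" using xc no by simp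
    ultimately obtain k where k: "P k \<subseteq> {z \<in> carrier G. x \<otimes> inv z \<in> carrier G - ?C}"
      using open_contains_lower_p_series by blast
    obtain c z where c: "c \<in> power_products G UNIV (p ^ n) as" and z: "z \<in> P (n + k)"
      and xcz: "x = c \<otimes> z" using power_products_dense[OF as gen x] by blast
    have cc: "c \<in> carrier G" using c power_products_closed[OF as] by blast
    have "z \<in> P k" using z lower_p_series_antimono[of k "n + k"] by auto
    then have "x \<otimes> inv z \<notin> ?C" using k by blast
    moreover have "x \<otimes> inv z = c"
      using cc lower_p_series_carrier[OF z] by (simp add: xcz m_assoc)
    ultimately show False using c power_products_subset_procyclic[OF as] by blast
  qed
qed

corollary openin_subgroup_procyclicI:
  assumes as: "set as \<subseteq> carrier G" and gen: "closed_span (set as) = carrier G"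
    and S: "subgroup S G" "\<And>a. a \<in> carrier G \<Longrightarrow> \<exists>n. closed_span {a [^] (p ^ n)} \<subseteq> S"
  shows "openin T S"
proof -
  obtain f where f: "\<And>a. a \<in> carrier G \<Longrightarrow> closed_span {a [^] (p ^ f a)} \<subseteq> S" using S(2) by metis
  \<comment> \<open>Any common upper bound of the depths for the finitely many generators will do.\<close>
  define n where "n = (\<Sum>a\<in>set as. f a)"
  have "closed_span {a [^] (p ^ n)} \<subseteq> S" if a: "a \<in> set as" for a
  proof -
    have ac: "a \<in> carrier G" using a as by blast
    have sub: "{a [^] (p ^ f a)} \<subseteq> carrier G" using ac by simp
    have "f a \<le> n" unfolding n_def using a by (intro member_le_sum) auto
    then have "a [^] (p ^ n) = (a [^] (p ^ f a)) [^] (p ^ (n - f a))"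
      using ac by (simp add: nat_pow_pow flip: power_add)
    then have "a [^] (p ^ n) \<in> closed_span {a [^] (p ^ f a)}"
      using subgroup_nat_pow[OF subgroup_closed_span[OF sub]] subset_closed_span[OF sub] by simp
    then have "closed_span {a [^] (p ^ n)} \<subseteq> closed_span {a [^] (p ^ f a)}"
      by (intro closed_span_minimal subgroup_closed_span[OF sub] closedin_closed_span[OF sub]) simp
    then show ?thesis using f[OF ac] by blast
  qed
  then have "P n \<subseteq> S"
    using lower_p_series_subset_procyclic_products[OF as gen] procyclic_products_subset[OF S(1)] by blast
  then show ?thesis
    by (rule openin_subgroupI[OF S(1) openin_lower_p_series[OF as gen]
          subgroup.one_closed[OF subgroup_lower_p_series]])
qed

end

section \<open>Cocycles on procyclic subgroups\<close>

context pro_p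
begin

text \<open>
  Centralizers are closed, as the group is Hausdorff. Hence first \<open>a\<close>, and then all of its closed span,
  commutes with every element of the closed span.
\<close>

lemma closed_span_singleton_commute:
  assumes a: "a \<in> carrier G" and x: "x \<in> closed_span {a}" and y: "y \<in> closed_span {a}"
  shows "x \<otimes> y = y \<otimes> x"
proof -
  have sub: "{a} \<subseteq> carrier G" using a by simp
  have car: "closed_span {a} \<subseteq> carrier G" using subgroup_closed_span[OF sub] by (rule subgroup.subset)
  have key: "closed_span {a} \<subseteq> {z \<in> carrier G. z \<otimes> b = b \<otimes> z}"
    if b: "b \<in> carrier G" and ab: "a \<otimes> b = b \<otimes> a" for b
  proof (rule closed_span_minimal)
    have "continuous_map T T (\<lambda>z. z \<otimes> b)" "continuous_map T T (\<lambda>z. b \<otimes> z)"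
      using b by (auto intro!: continuous_map_times continuous_map_carrier_const)
    then have "closedin T {z \<in> topspace T. z \<otimes> b = b \<otimes> z}"
      by (rule closedin_continuous_maps_eq[OF Hausdorff])
    then show "closedin T {z \<in> carrier G. z \<otimes> b = b \<otimes> z}" by (simp add: topspace_eq)
    show "subgroup {z \<in> carrier G. z \<otimes> b = b \<otimes> z} G"
      by unfold_locales (use b in \<open>auto intro: commutes_mult commutes_inv\<close>)
  qed (use a ab in auto)
  have "x \<otimes> a = a \<otimes> x" using key[OF a refl] x by blast
  then have "a \<otimes> x = x \<otimes> a" by simp
  then have "y \<otimes> x = x \<otimes> y" using key[of x] x y car by blast
  then show ?thesis by simp
qed

lemma pow_prime_power_in_open:
  assumes S: "subgroup S G" "openin T S" and a: "a \<in> carrier G"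
  shows "\<exists>n. closed_span {a [^] (p ^ n)} \<subseteq> S"
proof -
  obtain n where "P n \<subseteq> S" using open_contains_lower_p_series[OF S(2) subgroup.one_closed[OF S(1)]] ..
  then have "a [^] (p ^ n) \<in> S" using pow_prime_power_in_lower_p_series[OF a] by blast
  then have "closed_span {a [^] (p ^ n)} \<subseteq> S"
    by (intro closed_span_minimal[OF S(1) closedin_open_subgroup[OF S]]) simp
  then show ?thesis ..
qed

text \<open>
  Write \<open>l = m p ^ s\<close> with \<open>m\<close> prime to \<open>p\<close>. In a procyclic pro-\<open>p\<close> group raising to the \<open>m\<close>-th power is
  invertible, so the \<open>l\<close>-th powers are the \<open>p ^ s\<close>-th powers. The \<open>l\<close>-th powers form a closed subgroup,
  hence it is enough to approximate \<open>a ^ (p ^ s)\<close> by them; modulo \<open>P k\<close> the exponent matters only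
  modulo \<open>p ^ k\<close>, and there \<open>m\<close> is a unit.
\<close>

lemma closed_span_subset_powers:
  assumes a: "a \<in> carrier G" and l: "l > 0"
  shows "\<exists>s. closed_span {a [^] (p ^ s)} \<subseteq> (\<lambda>x. x [^] (l::nat)) ` closed_span {a}"
proof -
  have sub: "{a} \<subseteq> carrier G" using a by simp
  let ?C = "closed_span {a}"
  let ?D = "(\<lambda>x. x [^] l) ` ?C"
  note C = subgroup_closed_span[OF sub] and aC = subset_closed_span[OF sub]
  have car: "x \<in> carrier G" if "x \<in> ?C" for x using subgroup.mem_carrier[OF C that] .
  obtain s m where lm: "l = m * p ^ s" and m: "\<not> p dvd m"
    using multiplicity_decompose'[of l p] prime_p l
    by (metis mult.commute not_prime_unit not_gr_zero)
  have D: "subgroup ?D G"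
  proof
    fix x y assume "x \<in> ?D" "y \<in> ?D"
    then obtain u v where u: "u \<in> ?C" "x = u [^] l" and v: "v \<in> ?C" "y = v [^] l" by blast
    have "x \<otimes> y = (u \<otimes> v) [^] l"
      unfolding u v using pow_mult_distrib[OF closed_span_singleton_commute[OF a u(1) v(1)] car[OF u(1)] car[OF v(1)]]
      by simp
    then show "x \<otimes> y \<in> ?D" using subgroup.m_closed[OF C u(1) v(1)] by blast
  next
    have "\<one> = \<one> [^] l" by simp
    then show "\<one> \<in> ?D" using subgroup.one_closed[OF C] by blast
  next
    fix x assume "x \<in> ?D"
    then obtain u where u: "u \<in> ?C" "x = u [^] l" by blast
    have "inv x = (inv u) [^] l" using car[OF u(1)] by (simp add: u nat_pow_inv)
    then show "inv x \<in> ?D" using subgroup.m_inv_closed[OF C u(1)] by blast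
  qed (use car in auto)
  have "continuous_map T T (\<lambda>y. y [^] l)"
    using continuous_map_nat_pow[OF continuous_map_id[of T]] by (simp add: id_def)
  then have "compactin T ?D"
    by (rule image_compactin[OF closedin_imp_compactin[OF closedin_closed_span[OF sub]]])
  then have Dcl: "closedin T ?D" by (rule compactin_imp_closedin[OF Hausdorff])
  have "a [^] (p ^ s) \<in> ?D"
  proof (rule ccontr)
    assume no: "a [^] (p ^ s) \<notin> ?D"
    have as: "a [^] (p ^ s) \<in> carrier G" using a by simp
    have op: "openin T (carrier G - ?D)" by (rule openin_diff[OF openin_carrier Dcl])
    have "openin T {z \<in> carrier G. a [^] (p ^ s) \<otimes> z \<in> carrier G - ?D}"
      by (rule openin_translate[OF op as])
    moreover have "\<one> \<in> {z \<in> carrier G. a [^] (p ^ s) \<otimes> z \<in> carrier G - ?D}"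
      using no as by simp
    ultimately obtain k where k: "P k \<subseteq> {z \<in> carrier G. a [^] (p ^ s) \<otimes> z \<in> carrier G - ?D}"
      using open_contains_lower_p_series by blast
    have "coprime p m" by (rule prime_imp_coprime[OF prime_p m])
    then have "coprime m (p ^ k)" by (simp add: coprime_commute)
    moreover have "m \<noteq> 0" using m by (metis dvd_0_right)
    ultimately obtain e t where e: "m * e = p ^ k * t + 1"
      using bezout_nat[of m "p ^ k"] by auto
    have "p ^ s + p ^ k * (t * p ^ s) = l * e"
    proof -
      have "l * e = p ^ s * (m * e)" unfolding lm by (simp only: mult_ac)
      also have "\<dots> = p ^ s * (p ^ k * t + 1)" by (simp only: e)
      finally show ?thesis by (simp add: algebra_simps)
    qed
    then have "a [^] (p ^ s) \<otimes> (a [^] (p ^ k)) [^] (t * p ^ s) = a [^] (l * e)"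
      using a by (simp only: nat_pow_pow nat_pow_mult)
    also have "\<dots> = (a [^] e) [^] l" using a by (simp add: nat_pow_pow mult.commute)
    also have "\<dots> \<in> ?D" using subgroup_nat_pow[OF C] aC by blast
    finally have "a [^] (p ^ s) \<otimes> (a [^] (p ^ k)) [^] (t * p ^ s) \<in> ?D" .
    moreover have "(a [^] (p ^ k)) [^] (t * p ^ s) \<in> P k"
      by (rule subgroup_nat_pow[OF subgroup_lower_p_series pow_prime_power_in_lower_p_series[OF a]])
    ultimately show False using k by blast
  qed
  then have "closed_span {a [^] (p ^ s)} \<subseteq> ?D" by (intro closed_span_minimal[OF D Dcl]) simp
  then show ?thesis ..
qed

end

lemma (in module) nat_multiple_eq_zero:
  assumes "[(n::nat)] \<cdot>\<^bsub>R\<^esub> \<one>\<^bsub>R\<^esub> = \<zero>\<^bsub>R\<^esub>" and x: "x \<in> carrier M"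
  shows "[n] \<cdot>\<^bsub>M\<^esub> x = \<zero>\<^bsub>M\<^esub>"
proof -
  have "([k] \<cdot>\<^bsub>R\<^esub> \<one>\<^bsub>R\<^esub>) \<odot>\<^bsub>M\<^esub> x = [k] \<cdot>\<^bsub>M\<^esub> x" for k :: nat
  proof (induction k)
    case (Suc k)
    have "([Suc k] \<cdot>\<^bsub>R\<^esub> \<one>\<^bsub>R\<^esub>) \<odot>\<^bsub>M\<^esub> x = ([k] \<cdot>\<^bsub>R\<^esub> \<one>\<^bsub>R\<^esub>) \<odot>\<^bsub>M\<^esub> x \<oplus>\<^bsub>M\<^esub> x"
      using x by (simp add: smult_l_distr)
    then show ?case using Suc by simp
  qed (use x in simp)
  from this[of n] show ?thesis using assms by simp
qed

text \<open>
  The cocycle argument of the introduction. The set \<open>A\<close> stands for the image of \<open>V1\<close> in \<open>V2\<close>, and \<open>H\<close>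
  for the stabilizer of the image of \<open>v\<close> in \<open>V3\<close>.
\<close>

lemma (in pro_p) stabilizer_contains_procyclic:
  fixes V :: "('k, 'v, 'm) module_scheme"
  assumes rep: "group_representation K G V \<rho>" and v: "v \<in> carrier V"
    and l: "(l::nat) > 0" "[l] \<cdot>\<^bsub>K\<^esub> \<one>\<^bsub>K\<^esub> = \<zero>\<^bsub>K\<^esub>"
    and A: "\<And>x. x \<in> A \<Longrightarrow> openin T (stabilizer G \<rho> x)"
    and H: "subgroup H G" "openin T H" "\<And>g. g \<in> H \<Longrightarrow> \<rho> g v \<ominus>\<^bsub>V\<^esub> v \<in> A"
    and a: "a \<in> carrier G"
  shows "\<exists>n. closed_span {a [^] (p ^ n)} \<subseteq> stabilizer G \<rho> v"
proof -
  interpret M: module K V using rep by (simp add: group_representation_def)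
  interpret act: group_action G "carrier V" \<rho> using rep by (simp add: group_representation_def)
  have closed [simp]: "\<rho> g x \<in> carrier V" if "g \<in> carrier G" "x \<in> carrier V" for g x
    using act.element_image that by blast
  have add: "\<rho> g (x \<oplus>\<^bsub>V\<^esub> y) = \<rho> g x \<oplus>\<^bsub>V\<^esub> \<rho> g y"
    if "g \<in> carrier G" "x \<in> carrier V" "y \<in> carrier V" for g x y
    using rep that by (simp add: group_representation_def linear_maps_def)
  define c where "c = (\<lambda>g. \<rho> g v \<ominus>\<^bsub>V\<^esub> v)"
  have cc [simp]: "c g \<in> carrier V" if "g \<in> carrier G" for g
    using that v by (simp add: c_def)
  have cv: "\<rho> g v = v \<oplus>\<^bsub>V\<^esub> c g" if "g \<in> carrier G" for g
    using that v by (simp add: c_def M.minus_eq M.a_comm[of "\<rho> g v"] M.r_neg2)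
  have stab: "subgroup (stabilizer G \<rho> x) G" if "x \<in> carrier V" for x
    using act.stabilizer_subgroup that .
  obtain n0 where n0: "closed_span {a [^] (p ^ n0)} \<subseteq> H"
    using pow_prime_power_in_open[OF H(1,2) a] ..
  define b where "b = a [^] (p ^ n0)"
  have bc: "b \<in> carrier G" using a by (simp add: b_def)
  then have bsub: "{b} \<subseteq> carrier G" by simp
  note C = subgroup_closed_span[OF bsub]
  have bC: "b \<in> closed_span {b}" using subset_closed_span[OF bsub] by simp
  have cA: "c g \<in> A" if "g \<in> closed_span {b}" for g
    using H(3) n0 that by (auto simp: c_def b_def)
  obtain n1 where n1: "closed_span {b [^] (p ^ n1)} \<subseteq> stabilizer G \<rho> (c b)"
    using pow_prime_power_in_open[OF stab[OF cc[OF bc]] A[OF cA[OF bC]] bc] ..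
  define d where "d = b [^] (p ^ n1)"
  have dc: "d \<in> carrier G" using bc by (simp add: d_def)
  have dC: "closed_span {d} \<subseteq> closed_span {b}"
    unfolding d_def
    by (rule closed_span_minimal[OF C closedin_closed_span[OF bsub]]) (use subgroup_nat_pow[OF C bC] in simp)
  obtain s where s: "closed_span {d [^] (p ^ s)} \<subseteq> (\<lambda>x. x [^] l) ` closed_span {d}"
    using closed_span_subset_powers[OF dc l(1)] ..
  have "g [^] l \<in> stabilizer G \<rho> v" if g: "g \<in> closed_span {d}" for g
  proof -
    have gC: "g \<in> closed_span {b}" using dC g by blast
    have gc: "g \<in> carrier G" using subgroup.mem_carrier[OF C gC] .
    have gcb: "\<rho> g (c b) = c b" using n1 g by (auto simp: d_def stabilizer_def)
    have bg: "b \<otimes> g = g \<otimes> b" by (rule closed_span_singleton_commute[OF bc bC gC])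
    \<comment> \<open>Since \<open>b g = g b\<close>, the vectors \<open>b (g v)\<close> and \<open>g (b v)\<close> agree; comparing them shows that
      \<open>b\<close> fixes \<open>c g\<close>.\<close>
    have "v \<oplus>\<^bsub>V\<^esub> c b \<oplus>\<^bsub>V\<^esub> \<rho> b (c g) = \<rho> b (\<rho> g v)"
      using bc gc v by (simp add: cv add)
    also have "\<dots> = \<rho> g (\<rho> b v)"
      using act.composition_rule[OF v bc gc] act.composition_rule[OF v gc bc] bg by simp
    also have "\<dots> = v \<oplus>\<^bsub>V\<^esub> c g \<oplus>\<^bsub>V\<^esub> c b"
      using bc gc v by (simp add: cv add gcb)
    also have "\<dots> = v \<oplus>\<^bsub>V\<^esub> c b \<oplus>\<^bsub>V\<^esub> c g"
      using bc gc v by (simp add: M.a_ac)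
    finally have "\<rho> b (c g) = c g"
      by (rule M.add.mult_left_cancel) (use bc gc v in simp_all)
    then have "b \<in> stabilizer G \<rho> (c g)" using bc by (simp add: stabilizer_def)
    then have Cs: "closed_span {b} \<subseteq> stabilizer G \<rho> (c g)"
      by (intro closed_span_minimal stab cc gc closedin_open_subgroup A cA gC) simp
    \<comment> \<open>All powers of \<open>g\<close> fix \<open>c g\<close>, so the cocycle is additive on them.\<close>
    have "\<rho> (g [^] m) v = v \<oplus>\<^bsub>V\<^esub> [m] \<cdot>\<^bsub>V\<^esub> c g" for m :: nat
    proof (induction m)
      case 0
      have "\<rho> \<one> v = v" using act.id_eq_one v by (metis restrict_apply')
      then show ?case using v by simp
    next
      case (Suc m)
      have "\<rho> (g [^] m) (c g) = c g"
        using Cs subgroup_nat_pow[OF C gC] by (auto simp: stabilizer_def)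
      then have "\<rho> (g [^] Suc m) v = \<rho> (g [^] m) v \<oplus>\<^bsub>V\<^esub> c g"
        using act.composition_rule[OF v _ gc, of "g [^] m"] gc v by (simp add: cv[OF gc] add)
      then show ?case using Suc gc v by (simp add: M.a_assoc)
    qed
    from this[of l] have "\<rho> (g [^] l) v = v"
      using M.nat_multiple_eq_zero[OF l(2) cc[OF gc]] v by simp
    then show ?thesis using gc by (simp add: stabilizer_def)
  qed
  then have "closed_span {d [^] (p ^ s)} \<subseteq> stabilizer G \<rho> v" using s by blast
  moreover have "d [^] (p ^ s) = a [^] (p ^ (n0 + n1 + s))"
    using a by (simp add: d_def b_def nat_pow_pow power_add mult.assoc)
  ultimately show ?thesis by metis
qed

text \<open>
  The theorem for a powerful pro-\<open>p\<close> group with finitely many topological generators, in terms of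
  stabilizers: \<open>stabilizer_contains_procyclic\<close> supplies the hypothesis of
  \<open>openin_subgroup_procyclicI\<close> for the stabilizer of a vector in the middle term.
\<close>

lemma (in powerful_pro_p) openin_stabilizer_extension:
  assumes as: "set as \<subseteq> carrier G" and gen: "closed_span (set as) = carrier G"
    and l: "(l::nat) > 0" "[l] \<cdot>\<^bsub>K\<^esub> \<one>\<^bsub>K\<^esub> = \<zero>\<^bsub>K\<^esub>"
    and ex: "rep_short_exact K G V1 \<rho>1 \<alpha> V2 \<rho>2 \<beta> V3 \<rho>3"
    and s1: "\<And>x. x \<in> carrier V1 \<Longrightarrow> openin T (stabilizer G \<rho>1 x)"
    and s3: "\<And>x. x \<in> carrier V3 \<Longrightarrow> openin T (stabilizer G \<rho>3 x)"
    and v: "v \<in> carrier V2"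
  shows "openin T (stabilizer G \<rho>2 v)"
proof -
  have rep1: "group_representation K G V1 \<rho>1" and rep2: "group_representation K G V2 \<rho>2"
    and rep3: "group_representation K G V3 \<rho>3"
    and \<alpha>: "\<alpha> \<in> rep_hom K G V1 \<rho>1 V2 \<rho>2" and \<beta>: "\<beta> \<in> rep_hom K G V2 \<rho>2 V3 \<rho>3"
    and ker: "\<alpha> ` carrier V1 = a_kernel V2 V3 \<beta>"
    using ex by (auto simp: rep_short_exact_def)
  interpret M2: module K V2 using rep2 by (simp add: group_representation_def)
  interpret M3: module K V3 using rep3 by (simp add: group_representation_def)
  interpret act1: group_action G "carrier V1" \<rho>1 using rep1 by (simp add: group_representation_def)
  interpret act2: group_action G "carrier V2" \<rho>2 using rep2 by (simp add: group_representation_def)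
  interpret act3: group_action G "carrier V3" \<rho>3 using rep3 by (simp add: group_representation_def)
  have \<alpha>c: "\<alpha> x \<in> carrier V2" if "x \<in> carrier V1" for x
    using \<alpha> that by (auto simp: rep_hom_def linear_maps_def)
  have \<alpha>eq: "\<alpha> (\<rho>1 g x) = \<rho>2 g (\<alpha> x)" if "g \<in> carrier G" "x \<in> carrier V1" for g x
    using \<alpha> that by (auto simp: rep_hom_def)
  have \<beta>c: "\<beta> x \<in> carrier V3" if "x \<in> carrier V2" for x
    using \<beta> that by (auto simp: rep_hom_def linear_maps_def)
  have \<beta>eq: "\<beta> (\<rho>2 g x) = \<rho>3 g (\<beta> x)" if "g \<in> carrier G" "x \<in> carrier V2" for g x
    using \<beta> that by (auto simp: rep_hom_def)
  have \<beta>add: "\<beta> (x \<oplus>\<^bsub>V2\<^esub> y) = \<beta> x \<oplus>\<^bsub>V3\<^esub> \<beta> y" if "x \<in> carrier V2" "y \<in> carrier V2" for x y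
    using \<beta> that by (auto simp: rep_hom_def linear_maps_def)
  define A where "A = \<alpha> ` carrier V1"
  have A: "openin T (stabilizer G \<rho>2 x)" if xA: "x \<in> A" for x
  proof -
    obtain u where u: "u \<in> carrier V1" "x = \<alpha> u" using xA unfolding A_def by blast
    have "stabilizer G \<rho>1 u \<subseteq> stabilizer G \<rho>2 x"
      using \<alpha>eq u by (auto simp: stabilizer_def) metis
    then show ?thesis
      using u by (intro openin_subgroupI[OF act2.stabilizer_subgroup s1 subgroup.one_closed[OF act1.stabilizer_subgroup]])
        (auto simp: \<alpha>c)
  qed
  have diff: "\<rho>2 g v \<ominus>\<^bsub>V2\<^esub> v \<in> A" if g: "g \<in> stabilizer G \<rho>3 (\<beta> v)" for g
  proof -
    have gc: "g \<in> carrier G" and inv: "\<rho>3 g (\<beta> v) = \<beta> v" using g by (auto simp: stabilizer_def)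
    have w: "\<rho>2 g v \<in> carrier V2" using act2.element_image[OF gc v] by simp
    then have d: "\<rho>2 g v \<ominus>\<^bsub>V2\<^esub> v \<in> carrier V2" using v by simp
    have "\<rho>2 g v \<ominus>\<^bsub>V2\<^esub> v \<oplus>\<^bsub>V2\<^esub> v = \<rho>2 g v" using w v by (simp add: M2.minus_eq M2.a_assoc M2.l_neg)
    then have "\<beta> (\<rho>2 g v \<ominus>\<^bsub>V2\<^esub> v) \<oplus>\<^bsub>V3\<^esub> \<beta> v = \<beta> v"
      using \<beta>add[OF d v] \<beta>eq[OF gc v] inv by simp
    then have "\<beta> (\<rho>2 g v \<ominus>\<^bsub>V2\<^esub> v) = \<zero>\<^bsub>V3\<^esub>"
      using \<beta>c[OF d] \<beta>c[OF v] by simp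
    then show ?thesis unfolding A_def ker a_kernel_def' using d by simp
  qed
  show ?thesis
  proof (rule openin_subgroup_procyclicI[OF as gen act2.stabilizer_subgroup[OF v]])
    fix a assume "a \<in> carrier G"
    then show "\<exists>n. closed_span {a [^] (p ^ n)} \<subseteq> stabilizer G \<rho>2 v"
      by (intro stabilizer_contains_procyclic[OF rep2 v l A act3.stabilizer_subgroup[OF \<beta>c[OF v]]
            s3[OF \<beta>c[OF v]] diff])
  qed
qed

section \<open>Smoothness and restriction to an open subgroup\<close>

lemma (in topological_group) smooth_rep_iff:
  assumes "group_action G (carrier V) \<rho>"
  shows "smooth_rep T V \<rho> \<longleftrightarrow> (\<forall>x\<in>carrier V. openin T (stabilizer G \<rho> x))"
proof
  interpret act: group_action G "carrier V" \<rho> by fact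
  assume sm: "smooth_rep T V \<rho>"
  show "\<forall>x\<in>carrier V. openin T (stabilizer G \<rho> x)"
  proof
    fix x assume x: "x \<in> carrier V"
    have "continuous_map T (prod_topology T (discrete_topology (carrier V))) (\<lambda>g. (g, x))"
      using x continuous_map_id[of T] by (intro continuous_map_pairedI) (simp_all add: id_def)
    from continuous_map_compose[OF this sm[unfolded smooth_rep_def]]
    have "continuous_map T (discrete_topology (carrier V)) (\<lambda>g. \<rho> g x)" by (simp add: o_def)
    from openin_continuous_map_preimage[OF this, of "{x}"] x
    show "openin T (stabilizer G \<rho> x)" by (simp add: stabilizer_def topspace_eq)
  qed
next
  interpret act: group_action G "carrier V" \<rho> by fact
  assume st: "\<forall>x\<in>carrier V. openin T (stabilizer G \<rho> x)"
  let ?X = "prod_topology T (discrete_topology (carrier V))"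
  show "smooth_rep T V \<rho>"
    unfolding smooth_rep_def continuous_map_def
  proof (intro conjI allI impI)
    show "(\<lambda>(g, x). \<rho> g x) \<in> topspace ?X \<rightarrow> topspace (discrete_topology (carrier V))"
      using act.element_image by (auto simp: topspace_eq)
    fix Y
    show "openin ?X {z \<in> topspace ?X. (case z of (g, x) \<Rightarrow> \<rho> g x) \<in> Y}"
    proof (subst openin_subopen, intro ballI)
      fix z assume z: "z \<in> {z \<in> topspace ?X. (case z of (g, x) \<Rightarrow> \<rho> g x) \<in> Y}"
      then obtain g x where gx: "z = (g, x)" "g \<in> carrier G" "x \<in> carrier V" "\<rho> g x \<in> Y"
        by (auto simp: topspace_eq)
      define W where "W = {k \<in> carrier G. inv g \<otimes> k \<in> stabilizer G \<rho> x}"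
      have "openin T W" unfolding W_def using st gx by (intro openin_translate) auto
      then have "openin ?X (W \<times> {x})" using gx by (simp add: openin_prod_Times_iff)
      moreover have "z \<in> W \<times> {x}"
        using gx act.stabilizer_one_closed[OF gx(3)] by (simp add: W_def)
      moreover have "W \<times> {x} \<subseteq> {z \<in> topspace ?X. (case z of (g, x) \<Rightarrow> \<rho> g x) \<in> Y}"
      proof clarify
        fix k assume k: "k \<in> W"
        then have kc: "k \<in> carrier G" and "\<rho> (inv g \<otimes> k) x = x" by (auto simp: W_def stabilizer_def)
        then have "\<rho> g x = \<rho> (g \<otimes> (inv g \<otimes> k)) x"
          using act.composition_rule[OF gx(3,2), of "inv g \<otimes> k"] gx by simp
        also have "g \<otimes> (inv g \<otimes> k) = k" using kc gx by (simp flip: m_assoc)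
        finally show "(k, x) \<in> topspace ?X \<and> \<rho> k x \<in> Y" using kc gx by (simp add: topspace_eq)
      qed
      ultimately show "\<exists>S. openin ?X S \<and> z \<in> S \<and>
          S \<subseteq> {z \<in> topspace ?X. (case z of (g, x) \<Rightarrow> \<rho> g x) \<in> Y}" by blast
    qed
  qed
qed

lemma group_representation_restrict:
  assumes "group_representation K G V \<rho>" "subgroup U G"
  shows "group_representation K (G\<lparr>carrier := U\<rparr>) V \<rho>"
  using assms group_action.induced_action[of G "carrier V" \<rho> U] subgroup.subset[of U G]
  by (auto simp: group_representation_def)

lemma rep_short_exact_restrict:
  assumes "rep_short_exact K G V1 \<rho>1 \<alpha> V2 \<rho>2 \<beta> V3 \<rho>3" "subgroup U G"
  shows "rep_short_exact K (G\<lparr>carrier := U\<rparr>) V1 \<rho>1 \<alpha> V2 \<rho>2 \<beta> V3 \<rho>3"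
  using assms(1) subgroup.subset[OF assms(2)]
  by (auto simp: rep_short_exact_def rep_hom_def intro: group_representation_restrict[OF _ assms(2)])

lemma stabilizer_restrict:
  "subgroup U G \<Longrightarrow> stabilizer (G\<lparr>carrier := U\<rparr>) \<rho> x = U \<inter> stabilizer G \<rho> x"
  by (auto simp: stabilizer_def subgroup.mem_carrier)

text \<open>
  The greatest common divisor of a set of natural numbers vanishes exactly when the set is contained
  in \<open>{0}\<close>, so positive characteristic provides a positive integer that annihilates \<open>K\<close>.
\<close>

lemma ring_characteristic_pos_imp:
  assumes "0 < ring_characteristic K"
  obtains l :: nat where "l > 0" "[l] \<cdot>\<^bsub>K\<^esub> \<one>\<^bsub>K\<^esub> = \<zero>\<^bsub>K\<^esub>"
proof -
  have "\<not> {n::nat. [n] \<cdot>\<^bsub>K\<^esub> \<one>\<^bsub>K\<^esub> = \<zero>\<^bsub>K\<^esub>} \<subseteq> {0}"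
    using assms by (auto simp: ring_characteristic_def simp flip: Gcd_0_iff)
  then show thesis using that by auto
qed

text \<open>
  An open subgroup detects whether stabilizers are open, so the exact sequence may be restricted to
  an open powerful pro-\<open>p\<close> subgroup with finitely many topological generators.
\<close>

theorem corollary7:
  fixes K :: "('k, 'r) ring_scheme"
    and p :: nat
    and G :: "('g, 'h) monoid_scheme"
    and T :: "'g topology"
    and V1 :: "('k, 'u, 'l) module_scheme"
    and V2 :: "('k, 'v, 'm) module_scheme"
    and V3 :: "('k, 'w, 'n) module_scheme"
    and \<rho>1 :: "'g \<Rightarrow> 'u \<Rightarrow> 'u"
    and \<rho>2 :: "'g \<Rightarrow> 'v \<Rightarrow> 'v"
    and \<rho>3 :: "'g \<Rightarrow> 'w \<Rightarrow> 'w"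
    and \<alpha> :: "'u \<Rightarrow> 'v"
    and \<beta> :: "'v \<Rightarrow> 'w"
  assumes "field K"
    and "0 < ring_characteristic K"
    and "Factorial_Ring.prime p"
    and "p_adic_analytic_group p G T"
    and "rep_short_exact K G V1 \<rho>1 \<alpha> V2 \<rho>2 \<beta> V3 \<rho>3"
    and "smooth_rep T V1 \<rho>1"
    and "smooth_rep T V3 \<rho>3"
  shows "smooth_rep T V2 \<rho>2"
proof -
  interpret topological_group G T using assms(4) by (simp add: p_adic_analytic_group_def)
  obtain U where U: "subgroup U G" "openin T U"
    and pow: "powerful_pro_p_group p (G\<lparr>carrier := U\<rparr>) (subtopology T U)"
    and fg: "topologically_fin_gen (G\<lparr>carrier := U\<rparr>) (subtopology T U)"
    using assms(4) by (auto simp: p_adic_analytic_group_def)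
  interpret U: powerful_pro_p "G\<lparr>carrier := U\<rparr>" "subtopology T U" p
    using pow assms(3)
    by (intro powerful_pro_p.intro pro_p.intro pro_p_axioms.intro powerful_pro_p_axioms.intro)
      (auto simp: powerful_pro_p_group_def pro_p_group_def profinite_group_def)
  obtain as where as: "set as \<subseteq> carrier (G\<lparr>carrier := U\<rparr>)"
    and gen: "U.closed_span (set as) = carrier (G\<lparr>carrier := U\<rparr>)"
    using fg unfolding topologically_fin_gen_def U.closed_span_def by (metis finite_list)
  obtain l :: nat where l: "l > 0" "[l] \<cdot>\<^bsub>K\<^esub> \<one>\<^bsub>K\<^esub> = \<zero>\<^bsub>K\<^esub>"
    using ring_characteristic_pos_imp[OF assms(2)] by blast
  have act: "group_action G (carrier V1) \<rho>1" "group_action G (carrier V2) \<rho>2" "group_action G (carrier V3) \<rho>3"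
    using assms(5) by (auto simp: rep_short_exact_def group_representation_def)
  note stab = stabilizer_restrict[OF U(1)]
  have s1: "openin (subtopology T U) (stabilizer (G\<lparr>carrier := U\<rparr>) \<rho>1 x)" if "x \<in> carrier V1" for x
    using smooth_rep_iff[OF act(1)] assms(6) that U(2) by (auto simp: stab openin_subtopology)
  have s3: "openin (subtopology T U) (stabilizer (G\<lparr>carrier := U\<rparr>) \<rho>3 x)" if "x \<in> carrier V3" for x
    using smooth_rep_iff[OF act(3)] assms(7) that U(2) by (auto simp: stab openin_subtopology)
  show ?thesis
    unfolding smooth_rep_iff[OF act(2)]
  proof
    fix v assume v: "v \<in> carrier V2"
    have "openin (subtopology T U) (stabilizer (G\<lparr>carrier := U\<rparr>) \<rho>2 v)"
      by (rule U.openin_stabilizer_extension[OF as gen l rep_short_exact_restrict[OF assms(5) U(1)] s1 s3 v])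
    then have op: "openin T (U \<inter> stabilizer G \<rho>2 v)"
      using openin_trans_full[OF _ U(2)] by (simp add: stab)
    note S = group_action.stabilizer_subgroup[OF act(2) v]
    show "openin T (stabilizer G \<rho>2 v)"
      using subgroup.one_closed[OF U(1)] subgroup.one_closed[OF S]
      by (intro openin_subgroupI[OF S op]) auto
  qed
qed

end
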